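(* Let $k$ be an algebraically closed field, $Q$ a finite connected acyclic quiver, $\mathbf{1}=(1,\dots,1)\in\mathbb{Z}^{Q_0}$, and $\theta$ a stability condition which is generic for $\mathbf{1}$. Let $M\in R(Q,\mathbf{1})^\theta$. The orbit of $[M]\in M^\theta(Q,\mathbf{1})$ under $T_0$ is one-dimensional if and only if $\mathrm{supp}(M)$ is a $\theta$-stable spanning almost tree.
   Context: $R(Q,\mathbf{1})=k^{Q_1}$ is the space of representations $M=(M_\alpha)_{\alpha\in Q_1}$ of $Q$ of dimension vector $\mathbf{1}$. The torus $G_{\mathbf{1}}=\mathbb{G}_m^{Q_0}$ acts by $g\cdot M=(g_{t(\alpha)}g_{s(\alpha)}^{-1}M_\alpha)_\alpha$ ($s,t$ = source, target); the diagonal $\Delta\cong\mathbb{G}_m$ acts trivially and $PG_{\mathbf{1}}=G_{\mathbf{1}}/\Delta$. $T=\mathbb{G}_m^{Q_1}$ acts by $t.M=(t_\alpha M_\alpha)_\alpha$. Let $\sigma_Q:G_{\mathbf{1}}\to T$, $g\mapsto(g_{t(\alpha)}g_{s(\alpha)}^{-1})_\alpha$, and $T_0:=T/\sigma_Q(G_{\mathbf{1}})$. A stability condition is a $\mathbb{Z}$-linear map $\theta:\mathbb{Z}^{Q_0}\to\mathbb{Z}$; the slope is $\mu(e)=\theta(e)/\sum_ie_i$ for a non-zero dimension vector $e$; $M$ is $\theta$-semi-stable (resp. $\theta$-stable) if $\mu(\underline{\dim}M')\le\mu(\underline{\dim}M)$ (resp. $<$) for all non-zero proper subrepresentations $M'$.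 $\theta$ is generic for $\mathbf{1}$ if the semi-stable and stable loci of $R(Q,\mathbf{1})$ agree; this locus is denoted $R(Q,\mathbf{1})^\theta$, and $M^\theta(Q,\mathbf{1})=R(Q,\mathbf{1})^\theta/PG_{\mathbf{1}}$ is the geometric quotient. The $T$-action descends to it and factors through $T_0$. $\mathrm{supp}(M)=\{\alpha\in Q_1\mid M_\alpha\neq0\}$. $H\subseteq Q_1$ is a spanning tree if the underlying unoriented (multi)graph of $(Q_0,H)$ is connected and cycle-free. $\Omega\subseteq Q_1$ is a spanning almost tree if it is not a spanning tree but there exists $\alpha\in\Omega$ such that $\Omega\setminus\{\alpha\}$ is a spanning tree. $\Omega$ is $\theta$-stable if the representation $M_\Omega$ with $(M_\Omega)_\alpha=1$ for $\alpha\in\Omega$ and $0$ otherwise is $\theta$-stable. *)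

theory Defs
  imports
    "HOL-Analysis.Analysis"
    "HOL-Algebra.Coset"
    "HOL-Library.Extended_Nat"
    "Graph_Theory.Digraph_Component"
begin

section \<open>Quivers, undirected cycles, spanning trees\<close>

text \<open>
  A quiver is a \<^typ>\<open>('v, 'a) pre_digraph\<close>: \<^const>\<open>verts\<close> is the set of vertices,
  \<^const>\<open>arcs\<close> the set of arrows, \<^const>\<open>tail\<close> the source and \<^const>\<open>head\<close> the target map;
  loops and parallel arrows are allowed.  It is connected in the sense of
  \<^const>\<open>Digraph_Component.connected\<close>, which also requires a vertex.
\<close>

definition acyclic_quiver :: "('v, 'a) pre_digraph \<Rightarrow> bool" where
  "acyclic_quiver Q \<longleftrightarrow> \<not> (\<exists>p. pre_digraph.cycle Q p)"

text \<open>
  Each arrow can be traversed in both directions; \<open>(\<alpha>, False)\<close> is \<open>\<alpha>\<close> traversed backwards.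
  In a cycle of the underlying unoriented multigraph no edge may be used twice: going back
  and forth along one arrow is not a cycle, but a loop and a pair of parallel (or opposite) arrows are.
  The constants \<^const>\<open>Digraph_Component.forest\<close> and \<^const>\<open>Digraph_Component.spanning_tree\<close>
  exclude directed cycles only and are therefore not the notions needed here.
\<close>

definition doubled :: "('v, 'a) pre_digraph \<Rightarrow> ('v, 'a \<times> bool) pre_digraph" where
  "doubled Q = \<lparr>verts = verts Q, arcs = arcs Q \<times> UNIV,
     tail = (\<lambda>(\<alpha>, b). if b then tail Q \<alpha> else head Q \<alpha>),
     head = (\<lambda>(\<alpha>, b). if b then head Q \<alpha> else tail Q \<alpha>)\<rparr>"

definition undirected_cycle :: "('v, 'a) pre_digraph \<Rightarrow> ('a \<times> bool) list \<Rightarrow> bool" where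
  "undirected_cycle Q p \<longleftrightarrow> pre_digraph.cycle (doubled Q) p \<and> distinct (map fst p)"

definition is_spanning_tree :: "('v, 'a) pre_digraph \<Rightarrow> 'a set \<Rightarrow> bool" where
  "is_spanning_tree Q H \<longleftrightarrow> H \<subseteq> arcs Q \<and> Digraph_Component.connected (Q\<lparr>arcs := H\<rparr>)
     \<and> \<not> (\<exists>p. undirected_cycle (Q\<lparr>arcs := H\<rparr>) p)"

definition is_spanning_almost_tree :: "('v, 'a) pre_digraph \<Rightarrow> 'a set \<Rightarrow> bool" where
  "is_spanning_almost_tree Q \<Omega> \<longleftrightarrow> \<Omega> \<subseteq> arcs Q \<and> \<not> is_spanning_tree Q \<Omega>
     \<and> (\<exists>\<alpha>\<in>\<Omega>. is_spanning_tree Q (\<Omega> - {\<alpha>}))"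


section \<open>Representations of dimension vector one and stability\<close>

definition rep_space :: "('v, 'a) pre_digraph \<Rightarrow> ('a \<Rightarrow> 'k::field) set" where
  "rep_space Q = arcs Q \<rightarrow>\<^sub>E UNIV"

definition supp :: "('v, 'a) pre_digraph \<Rightarrow> ('a \<Rightarrow> 'k::field) \<Rightarrow> 'a set" where
  "supp Q M = {\<alpha> \<in> arcs Q. M \<alpha> \<noteq> 0}"

definition rep_of_arrows :: "('v, 'a) pre_digraph \<Rightarrow> 'a set \<Rightarrow> ('a \<Rightarrow> 'k::field)" where
  "rep_of_arrows Q \<Omega> = (\<lambda>\<alpha>\<in>arcs Q. if \<alpha> \<in> \<Omega> then 1 else 0)"

text \<open>Every vertex carries the vector space \<open>k\<close>, and the arrow \<open>\<alpha>\<close> acts as multiplication by \<open>M\<^sub>\<alpha>\<close>.\<close>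

definition subrep :: "('v, 'a) pre_digraph \<Rightarrow> ('a \<Rightarrow> 'k::field) \<Rightarrow> ('v \<Rightarrow> 'k set) \<Rightarrow> bool" where
  "subrep Q M U \<longleftrightarrow> (\<forall>i\<in>verts Q. vector_space_over_itself.subspace (U i))
     \<and> (\<forall>\<alpha>\<in>arcs Q. (\<lambda>x. M \<alpha> * x) ` U (tail Q \<alpha>) \<subseteq> U (head Q \<alpha>))"

definition nonzero_proper :: "('v, 'a) pre_digraph \<Rightarrow> ('v \<Rightarrow> 'k::field set) \<Rightarrow> bool" where
  "nonzero_proper Q U \<longleftrightarrow> (\<exists>i\<in>verts Q. U i \<noteq> {0}) \<and> (\<exists>i\<in>verts Q. U i \<noteq> UNIV)"

definition dim_vec :: "('v, 'a) pre_digraph \<Rightarrow> ('v \<Rightarrow> 'k::field set) \<Rightarrow> ('v \<Rightarrow> int)" where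
  "dim_vec Q U = (\<lambda>i\<in>verts Q. int (vector_space_over_itself.dim (U i)))"

definition ones :: "('v, 'a) pre_digraph \<Rightarrow> ('v \<Rightarrow> int)" where
  "ones Q = (\<lambda>i\<in>verts Q. 1)"

definition stability_condition :: "('v, 'a) pre_digraph \<Rightarrow> (('v \<Rightarrow> int) \<Rightarrow> int) \<Rightarrow> bool" where
  "stability_condition Q \<theta> \<longleftrightarrow>
     (\<forall>d \<in> verts Q \<rightarrow>\<^sub>E UNIV. \<forall>e \<in> verts Q \<rightarrow>\<^sub>E UNIV. \<theta> (\<lambda>i\<in>verts Q. d i + e i) = \<theta> d + \<theta> e)
     \<and> (\<forall>n. \<forall>d \<in> verts Q \<rightarrow>\<^sub>E UNIV. \<theta> (\<lambda>i\<in>verts Q. n * d i) = n * \<theta> d)"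

definition slope :: "('v, 'a) pre_digraph \<Rightarrow> (('v \<Rightarrow> int) \<Rightarrow> int) \<Rightarrow> ('v \<Rightarrow> int) \<Rightarrow> rat" where
  "slope Q \<theta> e = of_int (\<theta> e) / of_int (\<Sum>i\<in>verts Q. e i)"

definition semistable ::
    "('v, 'a) pre_digraph \<Rightarrow> (('v \<Rightarrow> int) \<Rightarrow> int) \<Rightarrow> ('a \<Rightarrow> 'k::field) \<Rightarrow> bool" where
  "semistable Q \<theta> M \<longleftrightarrow>
     (\<forall>U. subrep Q M U \<and> nonzero_proper Q U \<longrightarrow> slope Q \<theta> (dim_vec Q U) \<le> slope Q \<theta> (ones Q))"

definition stable ::
    "('v, 'a) pre_digraph \<Rightarrow> (('v \<Rightarrow> int) \<Rightarrow> int) \<Rightarrow> ('a \<Rightarrow> 'k::field) \<Rightarrow> bool" where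
  "stable Q \<theta> M \<longleftrightarrow>
     (\<forall>U. subrep Q M U \<and> nonzero_proper Q U \<longrightarrow> slope Q \<theta> (dim_vec Q U) < slope Q \<theta> (ones Q))"

definition stable_locus ::
    "('v, 'a) pre_digraph \<Rightarrow> (('v \<Rightarrow> int) \<Rightarrow> int) \<Rightarrow> ('a \<Rightarrow> 'k::field) set" where
  "stable_locus Q \<theta> = {M \<in> rep_space Q. stable Q \<theta> M}"

definition semistable_locus ::
    "('v, 'a) pre_digraph \<Rightarrow> (('v \<Rightarrow> int) \<Rightarrow> int) \<Rightarrow> ('a \<Rightarrow> 'k::field) set" where
  "semistable_locus Q \<theta> = {M \<in> rep_space Q. semistable Q \<theta> M}"

definition generic ::
    "'k::field itself \<Rightarrow> ('v, 'a) pre_digraph \<Rightarrow> (('v \<Rightarrow> int) \<Rightarrow> int) \<Rightarrow> bool" where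
  "generic _ Q \<theta> \<longleftrightarrow> (semistable_locus Q \<theta> :: ('a \<Rightarrow> 'k) set) = stable_locus Q \<theta>"


section \<open>Torus actions\<close>

definition torus :: "'i set \<Rightarrow> ('i \<Rightarrow> 'k::field) monoid" where
  "torus I = \<lparr>carrier = I \<rightarrow>\<^sub>E (UNIV - {0}), mult = (\<lambda>g h. \<lambda>i\<in>I. g i * h i), one = (\<lambda>i\<in>I. 1)\<rparr>"

definition diagonal :: "'i set \<Rightarrow> ('i \<Rightarrow> 'k::field) set" where
  "diagonal I = {\<lambda>i\<in>I. c | c. c \<noteq> 0}"

definition G_act :: "('v, 'a) pre_digraph \<Rightarrow> ('v \<Rightarrow> 'k::field) \<Rightarrow> ('a \<Rightarrow> 'k) \<Rightarrow> ('a \<Rightarrow> 'k)" where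
  "G_act Q g M = (\<lambda>\<alpha>\<in>arcs Q. g (head Q \<alpha>) * inverse (g (tail Q \<alpha>)) * M \<alpha>)"

definition T_act :: "('v, 'a) pre_digraph \<Rightarrow> ('a \<Rightarrow> 'k::field) \<Rightarrow> ('a \<Rightarrow> 'k) \<Rightarrow> ('a \<Rightarrow> 'k)" where
  "T_act Q t M = (\<lambda>\<alpha>\<in>arcs Q. t \<alpha> * M \<alpha>)"

definition sigma_map :: "('v, 'a) pre_digraph \<Rightarrow> ('v \<Rightarrow> 'k::field) \<Rightarrow> ('a \<Rightarrow> 'k)" where
  "sigma_map Q g = (\<lambda>\<alpha>\<in>arcs Q. g (head Q \<alpha>) * inverse (g (tail Q \<alpha>)))"

definition PG :: "('v, 'a) pre_digraph \<Rightarrow> ('v \<Rightarrow> 'k::field) set monoid" where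
  "PG Q = torus (verts Q) Mod diagonal (verts Q)"

definition T0 :: "('v, 'a) pre_digraph \<Rightarrow> ('a \<Rightarrow> 'k::field) set monoid" where
  "T0 Q = torus (arcs Q) Mod (sigma_map Q ` carrier (torus (verts Q)))"

text \<open>
  A coset \<open>C\<close> of the diagonal sends \<open>M\<close> to the common value of all \<open>g \<cdot> M\<close>, \<open>g \<in> C\<close>
  (\<open>PG_act_coset\<close> below).
\<close>

definition PG_act :: "('v, 'a) pre_digraph \<Rightarrow> ('v \<Rightarrow> 'k::field) set \<Rightarrow> ('a \<Rightarrow> 'k) \<Rightarrow> ('a \<Rightarrow> 'k)" where
  "PG_act Q C M = the_elem ((\<lambda>g. G_act Q g M) ` C)"

definition PG_orbit :: "('v, 'a) pre_digraph \<Rightarrow> ('a \<Rightarrow> 'k::field) \<Rightarrow> ('a \<Rightarrow> 'k) set" where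
  "PG_orbit Q M = {PG_act Q C M | C. C \<in> carrier (PG Q)}"

text \<open>
  The points of the quotient are orbits \<open>x\<close>, i.e. sets of representations.  For a coset \<open>C\<close>
  the set of all \<open>t . N\<close> with \<open>t \<in> C\<close> and \<open>N \<in> x\<close> is again a single orbit, namely that of any
  such \<open>t . N\<close> (\<open>T0_act_coset\<close> below).
\<close>

definition T0_act ::
    "('v, 'a) pre_digraph \<Rightarrow> ('a \<Rightarrow> 'k::field) set \<Rightarrow> ('a \<Rightarrow> 'k) set \<Rightarrow> ('a \<Rightarrow> 'k) set" where
  "T0_act Q C x = {T_act Q t N | t N. t \<in> C \<and> N \<in> x}"

definition T0_orbit :: "('v, 'a) pre_digraph \<Rightarrow> ('a \<Rightarrow> 'k::field) set \<Rightarrow> ('a \<Rightarrow> 'k) set set" where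
  "T0_orbit Q x = {T0_act Q C x | C. C \<in> carrier (T0 Q)}"

lemma group_torus: "group (torus I :: ('i \<Rightarrow> 'k::field) monoid)"
proof (rule groupI)
  fix x :: "'i \<Rightarrow> 'k"
  assume x: "x \<in> carrier (torus I)"
  show "\<exists>y\<in>carrier (torus I). y \<otimes>\<^bsub>torus I\<^esub> x = \<one>\<^bsub>torus I\<^esub>"
    using x by (intro bexI[of _ "\<lambda>i\<in>I. inverse (x i)"]) (auto simp: torus_def PiE_def Pi_def fun_eq_iff)
  show "\<one>\<^bsub>torus I\<^esub> \<otimes>\<^bsub>torus I\<^esub> x = x"
    using x by (auto simp: torus_def fun_eq_iff PiE_def extensional_def)
qed (auto simp: torus_def PiE_def Pi_def fun_eq_iff)

lemma comm_group_torus: "comm_group (torus I :: ('i \<Rightarrow> 'k::field) monoid)"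
  by (rule group.group_comm_groupI[OF group_torus]) (auto simp: torus_def fun_eq_iff)

lemma inv_torus:
  assumes "g \<in> carrier (torus I)"
  shows "inv\<^bsub>torus I\<^esub> g = (\<lambda>i\<in>I. inverse (g i))"
  by (rule group.inv_equality[OF group_torus])
    (use assms in \<open>auto simp: torus_def PiE_def Pi_def fun_eq_iff\<close>)

lemma subgroup_diagonal: "subgroup (diagonal I) (torus I :: ('i \<Rightarrow> 'k::field) monoid)"
proof -
  interpret group "torus I :: ('i \<Rightarrow> 'k) monoid" by (rule group_torus)
  show ?thesis
  proof (rule subgroupI)
    fix a b :: "'i \<Rightarrow> 'k"
    assume ab: "a \<in> diagonal I" "b \<in> diagonal I"
    then obtain c d where cd: "a = (\<lambda>i\<in>I. c)" "b = (\<lambda>i\<in>I. d)" "c \<noteq> 0" "d \<noteq> 0"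
      by (auto simp: diagonal_def)
    have "inv\<^bsub>torus I\<^esub> a = (\<lambda>i\<in>I. inverse c)"
      using cd by (subst inv_torus) (auto simp: torus_def fun_eq_iff)
    then show "inv\<^bsub>torus I\<^esub> a \<in> diagonal I"
      using cd unfolding diagonal_def by (auto intro!: exI[of _ "inverse c"])
    have "a \<otimes>\<^bsub>torus I\<^esub> b = (\<lambda>i\<in>I. c * d)"
      using cd by (auto simp: torus_def fun_eq_iff)
    then show "a \<otimes>\<^bsub>torus I\<^esub> b \<in> diagonal I"
      using cd unfolding diagonal_def by (auto intro!: exI[of _ "c * d"])
  qed (auto simp: diagonal_def torus_def intro: exI[of _ 1])
qed

lemma sigma_hom:
  assumes "wf_digraph Q"
  shows "group_hom (torus (verts Q)) (torus (arcs Q) :: ('a \<Rightarrow> 'k::field) monoid) (sigma_map Q)"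
proof -
  interpret wf_digraph Q by fact
  show ?thesis
    by (intro group_hom.intro group_torus group_hom_axioms.intro homI)
      (auto simp: torus_def sigma_map_def PiE_def Pi_def fun_eq_iff)
qed

lemma group_PG: "group (PG Q :: ('v \<Rightarrow> 'k::field) set monoid)"
  unfolding PG_def
  by (intro normal.factorgroup_is_group comm_group.subgroup_imp_normal comm_group_torus subgroup_diagonal)

lemma group_T0:
  assumes "wf_digraph Q"
  shows "group (T0 Q :: ('a \<Rightarrow> 'k::field) set monoid)"
  unfolding T0_def
  by (intro normal.factorgroup_is_group comm_group.subgroup_imp_normal comm_group_torus
      group_hom.img_is_subgroup sigma_hom assms)

lemma G_act_sigma: "G_act Q g M = T_act Q (sigma_map Q g) M"
  by (auto simp: G_act_def T_act_def sigma_map_def)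

lemma T_act_mult:
  "T_act Q s (T_act Q t M) = T_act Q (s \<otimes>\<^bsub>torus (arcs Q)\<^esub> t) M"
  by (auto simp: T_act_def torus_def fun_eq_iff)

lemma PG_act_coset:
  assumes "wf_digraph Q" "g \<in> carrier (torus (verts Q))"
  shows "PG_act Q (diagonal (verts Q) #>\<^bsub>torus (verts Q)\<^esub> g) M = G_act Q g M"
proof -
  interpret wf_digraph Q by fact
  have "G_act Q h M = G_act Q g M" if "h \<in> diagonal (verts Q) #>\<^bsub>torus (verts Q)\<^esub> g" for h
    using that by (auto simp: G_act_def r_coset_def diagonal_def torus_def fun_eq_iff)
  moreover have "g \<in> diagonal (verts Q) #>\<^bsub>torus (verts Q)\<^esub> g"
    using group.rcos_self[OF group_torus assms(2) subgroup_diagonal] .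
  ultimately have "(\<lambda>h. G_act Q h M) ` (diagonal (verts Q) #>\<^bsub>torus (verts Q)\<^esub> g) = {G_act Q g M}"
    by blast
  then show ?thesis by (simp add: PG_act_def)
qed

lemma PG_orbit_eq:
  assumes "wf_digraph Q"
  shows "PG_orbit Q M = {G_act Q g M | g. g \<in> carrier (torus (verts Q))}"
proof -
  have PG: "carrier (PG Q) = {diagonal (verts Q) #>\<^bsub>torus (verts Q)\<^esub> g | g. g \<in> carrier (torus (verts Q))}"
    by (auto simp: PG_def FactGroup_def RCOSETS_def)
  show ?thesis
    unfolding PG_orbit_def PG
    by (auto simp: PG_act_coset[OF assms]) (metis PG_act_coset[OF assms])
qed

lemma T0_act_coset:
  fixes t :: "'a \<Rightarrow> 'k::field"
  assumes "wf_digraph Q" "t \<in> carrier (torus (arcs Q))"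
  shows "T0_act Q ((sigma_map Q ` carrier (torus (verts Q))) #>\<^bsub>torus (arcs Q)\<^esub> t) (PG_orbit Q M)
           = PG_orbit Q (T_act Q t M)"
proof -
  interpret G: comm_group "torus (arcs Q) :: ('a \<Rightarrow> 'k) monoid" by (rule comm_group_torus)
  interpret V: group "torus (verts Q) :: (_ \<Rightarrow> 'k) monoid" by (rule group_torus)
  interpret s: group_hom "torus (verts Q)" "torus (arcs Q) :: ('a \<Rightarrow> 'k) monoid" "sigma_map Q"
    by (rule sigma_hom[OF assms(1)])
  have 1: "T_act Q (sigma_map Q g \<otimes>\<^bsub>torus (arcs Q)\<^esub> t) (G_act Q h M)
      = G_act Q (g \<otimes>\<^bsub>torus (verts Q)\<^esub> h) (T_act Q t M)"
    if "g \<in> carrier (torus (verts Q))" "h \<in> carrier (torus (verts Q))" for g h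
    using that assms(2) by (simp add: G_act_sigma T_act_mult G.m_ac)
  show ?thesis
  proof (intro equalityI subsetI)
    fix N assume "N \<in> T0_act Q ((sigma_map Q ` carrier (torus (verts Q))) #>\<^bsub>torus (arcs Q)\<^esub> t) (PG_orbit Q M)"
    then show "N \<in> PG_orbit Q (T_act Q t M)"
      unfolding T0_act_def r_coset_def PG_orbit_eq[OF assms(1)] using 1 by fastforce
  next
    fix N assume "N \<in> PG_orbit Q (T_act Q t M)"
    then obtain g where g: "g \<in> carrier (torus (verts Q))" "N = G_act Q g (T_act Q t M)"
      unfolding PG_orbit_eq[OF assms(1)] by auto
    then have "N = T_act Q (sigma_map Q g \<otimes>\<^bsub>torus (arcs Q)\<^esub> t) (G_act Q \<one>\<^bsub>torus (verts Q)\<^esub> M)"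
      using 1[of g "\<one>\<^bsub>torus (verts Q)\<^esub>"] by simp
    then show "N \<in> T0_act Q ((sigma_map Q ` carrier (torus (verts Q))) #>\<^bsub>torus (arcs Q)\<^esub> t) (PG_orbit Q M)"
      unfolding T0_act_def r_coset_def PG_orbit_eq[OF assms(1)] using g(1) by blast
  qed
qed


section \<open>Zariski topology, quotient topology, dimension\<close>

inductive_set poly_fun :: "'i set \<Rightarrow> (('i \<Rightarrow> 'k::field) \<Rightarrow> 'k) set" for I where
  const: "(\<lambda>_. c) \<in> poly_fun I"
| coord: "i \<in> I \<Longrightarrow> (\<lambda>x. x i) \<in> poly_fun I"
| add: "f \<in> poly_fun I \<Longrightarrow> g \<in> poly_fun I \<Longrightarrow> (\<lambda>x. f x + g x) \<in> poly_fun I"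
| mult: "f \<in> poly_fun I \<Longrightarrow> g \<in> poly_fun I \<Longrightarrow> (\<lambda>x. f x * g x) \<in> poly_fun I"

definition zariski :: "'i set \<Rightarrow> ('i \<Rightarrow> 'k::field) topology" where
  "zariski I = topology (\<lambda>U. \<exists>S \<subseteq> poly_fun I. U = {x \<in> I \<rightarrow>\<^sub>E UNIV. \<exists>f\<in>S. f x \<noteq> 0})"

lemma openin_zariski:
  "openin (zariski I) U \<longleftrightarrow> (\<exists>S \<subseteq> poly_fun I. U = {x \<in> I \<rightarrow>\<^sub>E UNIV. \<exists>f\<in>S. f x \<noteq> (0::'k::field)})"
proof -
  let ?D = "\<lambda>S. {x \<in> I \<rightarrow>\<^sub>E UNIV. \<exists>f\<in>S. f x \<noteq> (0::'k)}"
  have "istopology (\<lambda>U. \<exists>S \<subseteq> poly_fun I. U = ?D S)"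
    unfolding istopology_def
  proof (intro conjI allI impI)
    fix U V assume "\<exists>S\<subseteq>poly_fun I. U = ?D S" "\<exists>S\<subseteq>poly_fun I. V = ?D S"
    then obtain S S' where S: "S \<subseteq> poly_fun I" "U = ?D S" "S' \<subseteq> poly_fun I" "V = ?D S'"
      by auto
    let ?P = "{\<lambda>x. f x * g x | f g. f \<in> S \<and> g \<in> S'}"
    have "?P \<subseteq> poly_fun I" using S by (auto intro: poly_fun.mult)
    moreover have "U \<inter> V = ?D ?P" using S by fastforce
    ultimately show "\<exists>S\<subseteq>poly_fun I. U \<inter> V = ?D S" by blast
  next
    fix K assume K: "\<forall>U\<in>K. \<exists>S\<subseteq>poly_fun I. U = ?D S"
    let ?S = "{f \<in> poly_fun I. ?D {f} \<subseteq> \<Union>K}"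
    have "\<Union>K \<subseteq> ?D ?S"
    proof
      fix x assume "x \<in> \<Union>K"
      then obtain U where U: "U \<in> K" "x \<in> U" by auto
      then obtain S where S: "S \<subseteq> poly_fun I" "U = ?D S" using K by auto
      with U obtain f where f: "f \<in> S" "f x \<noteq> 0" by auto
      have "?D {f} \<subseteq> U" unfolding S(2) using f(1) by auto
      with U(1) have "?D {f} \<subseteq> \<Union>K" by (meson Union_upper subset_trans)
      with f(1) S(1) have "f \<in> ?S" by auto
      moreover have "x \<in> I \<rightarrow>\<^sub>E UNIV" using U(2) unfolding S(2) by simp
      ultimately show "x \<in> ?D ?S" using f(2) by auto
    qed
    moreover have "?D ?S \<subseteq> \<Union>K" by blast
    ultimately have "\<Union>K = ?D ?S" by (rule equalityI)
    then show "\<exists>S\<subseteq>poly_fun I. \<Union>K = ?D S" by (intro exI[of _ ?S] conjI) auto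
  qed
  then show ?thesis by (simp add: zariski_def)
qed

lemma topspace_zariski: "topspace (zariski I :: ('i \<Rightarrow> 'k::field) topology) = I \<rightarrow>\<^sub>E UNIV"
proof
  show "topspace (zariski I) \<subseteq> (I \<rightarrow>\<^sub>E UNIV :: ('i \<Rightarrow> 'k) set)"
    using openin_topspace[of "zariski I :: ('i \<Rightarrow> 'k) topology"] unfolding openin_zariski by auto
  have "openin (zariski I) (I \<rightarrow>\<^sub>E UNIV :: ('i \<Rightarrow> 'k) set)"
    unfolding openin_zariski by (rule exI[of _ "{\<lambda>_. 1}"]) (auto intro: poly_fun.const)
  then show "(I \<rightarrow>\<^sub>E UNIV :: ('i \<Rightarrow> 'k) set) \<subseteq> topspace (zariski I)"
    by (rule openin_subset)
qed

lemma closedin_zariski: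
  "closedin (zariski I) Z \<longleftrightarrow> (\<exists>S \<subseteq> poly_fun I. Z = {x \<in> I \<rightarrow>\<^sub>E UNIV. \<forall>f\<in>S. f x = (0::'k::field)})"
proof -
  have "(Z \<subseteq> I \<rightarrow>\<^sub>E UNIV \<and> (I \<rightarrow>\<^sub>E UNIV) - Z = {x \<in> I \<rightarrow>\<^sub>E UNIV. \<exists>f\<in>S. f x \<noteq> 0})
      \<longleftrightarrow> Z = {x \<in> I \<rightarrow>\<^sub>E UNIV. \<forall>f\<in>S. f x = (0::'k)}" for S
    by blast
  then show ?thesis
    unfolding closedin_def openin_zariski topspace_zariski by (simp flip: ex_simps add: conj_left_commute)
qed

definition quotient_topology :: "'x topology \<Rightarrow> ('x \<Rightarrow> 'y) \<Rightarrow> 'y topology" where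
  "quotient_topology X q =
     topology (\<lambda>U. U \<subseteq> q ` topspace X \<and> openin X {x \<in> topspace X. q x \<in> U})"

lemma openin_quotient_topology:
  "openin (quotient_topology X q) U \<longleftrightarrow> U \<subseteq> q ` topspace X \<and> openin X {x \<in> topspace X. q x \<in> U}"
proof -
  have "istopology (\<lambda>U. U \<subseteq> q ` topspace X \<and> openin X {x \<in> topspace X. q x \<in> U})"
    unfolding istopology_def
  proof (intro conjI allI impI)
    fix U V
    assume U: "U \<subseteq> q ` topspace X \<and> openin X {x \<in> topspace X. q x \<in> U}"
      and V: "V \<subseteq> q ` topspace X \<and> openin X {x \<in> topspace X. q x \<in> V}"
    have eq: "{x \<in> topspace X. q x \<in> U \<inter> V} = {x \<in> topspace X. q x \<in> U} \<inter> {x \<in> topspace X. q x \<in> V}"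
      by blast
    show "openin X {x \<in> topspace X. q x \<in> U \<inter> V}"
      unfolding eq using U V by (intro openin_Int) auto
    show "U \<inter> V \<subseteq> q ` topspace X" using U by blast
  next
    fix K assume K: "\<forall>U\<in>K. U \<subseteq> q ` topspace X \<and> openin X {x \<in> topspace X. q x \<in> U}"
    have eq: "{x \<in> topspace X. q x \<in> \<Union>K} = (\<Union>U\<in>K. {x \<in> topspace X. q x \<in> U})" by blast
    show "openin X {x \<in> topspace X. q x \<in> \<Union>K}"
      unfolding eq using K by (intro openin_Union) auto
    show "\<Union>K \<subseteq> q ` topspace X" using K by blast
  qed
  then show ?thesis by (simp add: quotient_topology_def)
qed

lemma topspace_quotient_topology: "topspace (quotient_topology X q) = q ` topspace X"
proof
  show "topspace (quotient_topology X q) \<subseteq> q ` topspace X"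
    using openin_topspace[of "quotient_topology X q"] unfolding openin_quotient_topology by blast
  have "{x \<in> topspace X. q x \<in> q ` topspace X} = topspace X" by blast
  then have "openin (quotient_topology X q) (q ` topspace X)"
    unfolding openin_quotient_topology by simp
  then show "q ` topspace X \<subseteq> topspace (quotient_topology X q)"
    by (rule openin_subset)
qed

lemma quotient_map_quotient_topology: "quotient_map X (quotient_topology X q) q"
  by (auto simp: quotient_map_def openin_quotient_topology topspace_quotient_topology)

definition irreducible_closed :: "'x topology \<Rightarrow> 'x set \<Rightarrow> bool" where
  "irreducible_closed X Z \<longleftrightarrow> closedin X Z \<and> Z \<noteq> {} \<and>
     (\<forall>A B. closedin X A \<and> closedin X B \<and> Z \<subseteq> A \<union> B \<longrightarrow> Z \<subseteq> A \<or> Z \<subseteq> B)"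

text \<open>
  The dimension of a topological space is the supremum of the lengths \<open>n\<close> of chains
  \<open>Z\<^sub>0 \<subset> \<dots> \<subset> Z\<^sub>n\<close> of irreducible closed subsets.  (The empty space gets dimension \<open>0\<close>; orbits are
  never empty.)
\<close>

definition krull_dim :: "'x topology \<Rightarrow> enat" where
  "krull_dim X = Sup {enat n | n. \<exists>Z :: nat \<Rightarrow> 'x set.
     (\<forall>i\<le>n. irreducible_closed X (Z i)) \<and> (\<forall>i<n. Z i \<subset> Z (Suc i))}"

text \<open>
  A geometric quotient of varieties is the set of orbits with the quotient topology (on
  closed points); the dimension of an orbit depends only on the induced topology.
\<close>

definition moduli_space ::
    "('v, 'a) pre_digraph \<Rightarrow> (('v \<Rightarrow> int) \<Rightarrow> int) \<Rightarrow> ('a \<Rightarrow> 'k::field) set topology" where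
  "moduli_space Q \<theta> =
     quotient_topology (subtopology (zariski (arcs Q)) (stable_locus Q \<theta>)) (PG_orbit Q)"

definition T0_orbit_dim ::
    "('v, 'a) pre_digraph \<Rightarrow> (('v \<Rightarrow> int) \<Rightarrow> int) \<Rightarrow> ('a \<Rightarrow> 'k::field) set \<Rightarrow> enat" where
  "T0_orbit_dim Q \<theta> x = krull_dim (subtopology (moduli_space Q \<theta>) (T0_orbit Q x))"

end

theory Submission
  imports Defs
begin

text \<open>
  Whether \<open>M\<close> is stable depends only on its support \<open>S\<close>, and stability forces \<open>S\<close> to be connected, so
  only the shape of \<open>S\<close> matters.  The \<open>T\<^sub>0\<close>-orbit of \<open>[M]\<close> is the set of \<open>G\<close>-orbits of representations
  with support \<open>S\<close>, a torus of rank \<open>|S| - |Q\<^sub>0| + 1\<close>; instead of its dimension only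
  the distinction between ranks \<open>0\<close>, \<open>1\<close> and \<open>\<ge> 2\<close> is needed.  Let \<open>H \<subseteq> S\<close> be a spanning tree.  The group \<open>G\<close>
  can be used to make any representation agree with \<open>M\<close> on \<open>H\<close>.  If \<open>S = H\<close>, the orbit is a point.
  If \<open>S = H \<union> {\<alpha>}\<close>, it is parametrised by the value at \<open>\<alpha>\<close>, and as a polynomial in one variable has
  finitely many zeros, it is an infinite space with the cofinite topology, hence of dimension \<open>1\<close>.
  If \<open>S\<close> contains two further arrows, varying none, one or both of their values gives
  three irreducible sets, whose closures form a chain of length \<open>2\<close>; that the inclusions are strict
  is seen from the invariant Laurent monomials attached to the two cycles.
\<close>


section \<open>Spanning trees of the underlying multigraph\<close>

text \<open>Adjacency in the underlying graph, used for connectedness only: it forgets which arrow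
  joins two vertices, so cycles are treated as walks in \<open>doubled\<close>.\<close>

definition edge_rel :: "('v, 'a) pre_digraph \<Rightarrow> 'a set \<Rightarrow> ('v \<times> 'v) set" where
  "edge_rel Q H = (\<Union>\<alpha>\<in>H. {(tail Q \<alpha>, head Q \<alpha>), (head Q \<alpha>, tail Q \<alpha>)})"

lemma sym_edge_rel: "sym (edge_rel Q H)"
  by (auto simp: edge_rel_def sym_def)

lemma edge_rel_rtrancl_sym: "(u, v) \<in> (edge_rel Q H)\<^sup>* \<Longrightarrow> (v, u) \<in> (edge_rel Q H)\<^sup>*"
  using sym_rtrancl[OF sym_edge_rel] by (rule symD)

lemma edge_rel_mono: "H \<subseteq> H' \<Longrightarrow> edge_rel Q H \<subseteq> edge_rel Q H'"
  by (auto simp: edge_rel_def)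

lemma wf_digraph_arcs_update: "wf_digraph Q \<Longrightarrow> H \<subseteq> arcs Q \<Longrightarrow> wf_digraph (Q\<lparr>arcs := H\<rparr>)"
  by (auto simp: wf_digraph_def)

lemma wf_digraph_doubled: "wf_digraph Q \<Longrightarrow> wf_digraph (doubled Q)"
  by (auto simp: wf_digraph_def doubled_def split: if_splits)

text \<open>\<open>connected\<close> is strong connectedness of \<open>mk_symmetric\<close>, whose
  arcs are exactly \<open>edge_rel\<close>, so reachability between vertices is its reflexive
  transitive closure.\<close>

lemma connected_iff_edge_rel:
  assumes "wf_digraph Q" "H \<subseteq> arcs Q"
  shows "Digraph_Component.connected (Q\<lparr>arcs := H\<rparr>) \<longleftrightarrow>
    verts Q \<noteq> {} \<and> (\<forall>u\<in>verts Q. \<forall>v\<in>verts Q. (u, v) \<in> (edge_rel Q H)\<^sup>*)"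
proof -
  let ?G = "mk_symmetric (Q\<lparr>arcs := H\<rparr>)"
  interpret G: pair_wf_digraph ?G
    by (intro wf_digraph.wellformed_mk_symmetric wf_digraph_arcs_update assms)
  have "arcs_ends (with_proj ?G) = edge_rel Q H"
    by (simp add: mk_symmetric_def edge_rel_def)
  then show ?thesis
    unfolding Digraph_Component.connected_def strongly_connected_def
    by (auto simp: G.reachable_conv')
qed

section \<open>Walks and cycles in the doubled quiver\<close>

lemma doubled_simps [simp]:
  "verts (doubled Q) = verts Q"
  "arcs (doubled Q) = arcs Q \<times> UNIV"
  "tail (doubled Q) (\<alpha>, b) = (if b then tail Q \<alpha> else head Q \<alpha>)"
  "head (doubled Q) (\<alpha>, b) = (if b then head Q \<alpha> else tail Q \<alpha>)"
  "tail (doubled (Q\<lparr>arcs := H\<rparr>)) = tail (doubled Q)"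
  "head (doubled (Q\<lparr>arcs := H\<rparr>)) = head (doubled Q)"
  by (simp_all add: doubled_def fun_eq_iff)

lemma awalk_verts_doubled_arcs_update:
  "pre_digraph.awalk_verts (doubled (Q\<lparr>arcs := H\<rparr>)) u p = pre_digraph.awalk_verts (doubled Q) u p"
  by (induction p arbitrary: u) (simp_all add: pre_digraph.awalk_verts.simps)

lemma cas_doubled_arcs_update:
  "pre_digraph.cas (doubled (Q\<lparr>arcs := H\<rparr>)) u p v = pre_digraph.cas (doubled Q) u p v"
  by (induction p arbitrary: u) (simp_all add: pre_digraph.cas.simps)

lemma awalk_doubled_arcs_update:
  assumes "H \<subseteq> arcs Q"
  shows "pre_digraph.awalk (doubled (Q\<lparr>arcs := H\<rparr>)) u p v \<longleftrightarrow>
    pre_digraph.awalk (doubled Q) u p v \<and> fst ` set p \<subseteq> H"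
  unfolding pre_digraph.awalk_def cas_doubled_arcs_update using assms by force

text \<open>Shrinking the set of arrows changes neither the ends nor the vertex lists of walks;
  cycles of a subquiver can therefore be discussed inside \<open>Q\<close> itself.\<close>

lemma undirected_cycle_arcs_update:
  assumes "H \<subseteq> arcs Q"
  shows "undirected_cycle (Q\<lparr>arcs := H\<rparr>) p \<longleftrightarrow> undirected_cycle Q p \<and> fst ` set p \<subseteq> H"
  unfolding undirected_cycle_def pre_digraph.cycle_def awalk_doubled_arcs_update[OF assms]
    awalk_verts_doubled_arcs_update by blast

lemma (in wf_digraph) awalk_doubled_imp_edge_rel:
  assumes "pre_digraph.awalk (doubled G) u p v" "fst ` set p \<subseteq> H"
  shows "(u, v) \<in> (edge_rel G H)\<^sup>*"
proof -
  interpret D: wf_digraph "doubled G"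
    by (rule wf_digraph_doubled) (rule wf_digraph_axioms)
  show ?thesis
    using assms
  proof (induction p arbitrary: u)
    case (Cons e p)
    obtain \<alpha> b where e: "e = (\<alpha>, b)" by fastforce
    have "(u, head (doubled G) e) \<in> edge_rel G H"
      using Cons.prems by (auto simp: e edge_rel_def D.awalk_simps)
    moreover have "(head (doubled G) e, v) \<in> (edge_rel G H)\<^sup>*"
      using Cons.prems by (intro Cons.IH) (auto simp: D.awalk_simps)
    ultimately show ?case by (rule converse_rtrancl_into_rtrancl)
  qed (simp add: D.awalk_simps)
qed

text \<open>A path rather than an arbitrary walk is extracted because its vertices are distinct,
  which \<open>distinct_fst_apath_doubled\<close> turns into distinct arrows.\<close>

lemma (in wf_digraph) edge_rel_imp_apath_doubled:
  assumes "(u, v) \<in> (edge_rel G H)\<^sup>*" "u \<in> verts G" "H \<subseteq> arcs G"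
  obtains p where "pre_digraph.apath (doubled G) u p v" "fst ` set p \<subseteq> H"
proof -
  have wf: "wf_digraph (G\<lparr>arcs := H\<rparr>)"
    by (rule wf_digraph_arcs_update) (use assms wf_digraph_axioms in auto)
  interpret D: wf_digraph "doubled (G\<lparr>arcs := H\<rparr>)"
    by (rule wf_digraph_doubled) (rule wf)
  have "arcs (doubled (G\<lparr>arcs := H\<rparr>)) = (\<lambda>\<alpha>. (\<alpha>, True)) ` H \<union> (\<lambda>\<alpha>. (\<alpha>, False)) ` H"
    by (auto intro: bool.exhaust)
  then have "arcs_ends (doubled (G\<lparr>arcs := H\<rparr>)) = edge_rel G H"
    unfolding arcs_ends_conv by (auto simp: edge_rel_def image_Un image_image)
  then have "reachable (doubled (G\<lparr>arcs := H\<rparr>)) u v"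
    using assms by (subst D.reachable_conv') auto
  then obtain p where "D.apath u p v"
    unfolding D.reachable_apath by blast
  then show ?thesis
    by (intro that[of p]) (simp_all add: pre_digraph.apath_def
      awalk_doubled_arcs_update[OF assms(3)] awalk_verts_doubled_arcs_update)
qed

text \<open>Using the first arrow again, in either direction, would bring the rest of the path to
  both ends of that arrow, hence back to the starting vertex.\<close>

lemma (in wf_digraph) distinct_fst_apath_doubled:
  assumes "pre_digraph.apath (doubled G) u p v"
  shows "distinct (map fst p)"
proof -
  interpret D: wf_digraph "doubled G"
    by (rule wf_digraph_doubled) (rule wf_digraph_axioms)
  show ?thesis
    using assms
  proof (induction p arbitrary: u)
    case (Cons e p)
    obtain \<alpha> b where e: "e = (\<alpha>, b)" by fastforce
    have u: "u = tail (doubled G) e"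
      and path: "D.apath (head (doubled G) e) p v"
      and notin: "u \<notin> set (D.awalk_verts (head (doubled G) e) p)"
      using Cons.prems by (auto simp: D.apath_simps)
    have "(\<alpha>, c) \<notin> set p" for c
    proof
      assume "(\<alpha>, c) \<in> set p"
      then have "{tail (doubled G) (\<alpha>, c), head (doubled G) (\<alpha>, c)}
          \<subseteq> set (D.awalk_verts (head (doubled G) e) p)"
        using D.awalk_verts_arc1 D.awalk_verts_arc2 D.awalkI_apath[OF path] by blast
      then show False using notin by (auto simp: u e split: if_splits)
    qed
    then have "\<alpha> \<notin> fst ` set p" by force
    then show ?case using Cons.IH[OF path] by (simp add: e)
  qed simp
qed

section \<open>Cycles, spanning trees and potentials\<close>

text \<open>A path in \<open>H\<close> from the head to the tail is closed up by \<alpha>; as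
  \<alpha> lies outside \<open>H\<close>, no arrow is repeated. For a loop the path is
  empty.\<close>

lemma (in wf_digraph) undirected_cycle_if_edge_rel:
  assumes "\<alpha> \<in> arcs G" "\<alpha> \<notin> H" "H \<subseteq> arcs G"
    and "(head G \<alpha>, tail G \<alpha>) \<in> (edge_rel G H)\<^sup>*"
  obtains p where "undirected_cycle G p" "fst ` set p \<subseteq> insert \<alpha> H"
proof -
  interpret D: wf_digraph "doubled G"
    by (rule wf_digraph_doubled) (rule wf_digraph_axioms)
  obtain p where p: "D.apath (head G \<alpha>) p (tail G \<alpha>)" "fst ` set p \<subseteq> H"
    using edge_rel_imp_apath_doubled[OF assms(4)] assms(1,3) by auto
  have "D.cycle ((\<alpha>, True) # p)"
    unfolding D.cycle_def
    by (rule exI[of _ "tail G \<alpha>"]) (use p assms in \<open>auto simp: D.apath_def D.awalk_simps\<close>)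
  moreover have "distinct (map fst ((\<alpha>, True) # p))"
    using distinct_fst_apath_doubled[OF p(1)] p(2) assms(2) by auto
  ultimately show ?thesis
    by (intro that[of "(\<alpha>, True) # p"]) (use p in \<open>auto simp: undirected_cycle_def\<close>)
qed

text \<open>The other arrows of the cycle form a detour around \<alpha>. Here \<alpha> is the first
  arrow of \<open>p\<close>, so the choice does not depend on \<open>H\<close>.\<close>

lemma (in wf_digraph) edge_rel_remove_cycle_arc:
  assumes "undirected_cycle G p"
  obtains \<alpha> where "\<alpha> \<in> fst ` set p"
    "\<And>H. fst ` set p \<subseteq> H \<Longrightarrow> (edge_rel G (H - {\<alpha>}))\<^sup>* = (edge_rel G H)\<^sup>*"
proof -
  interpret D: wf_digraph "doubled G"
    by (rule wf_digraph_doubled) (rule wf_digraph_axioms)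
  obtain u e p' where p: "p = e # p'" and awalk: "D.awalk u p u" and dist: "distinct (map fst p)"
    using assms unfolding undirected_cycle_def D.cycle_def by (metis neq_Nil_conv)
  obtain \<alpha> b where e: "e = (\<alpha>, b)" by fastforce
  have "(edge_rel G (H - {\<alpha>}))\<^sup>* = (edge_rel G H)\<^sup>*" if H: "fst ` set p \<subseteq> H" for H
  proof -
    let ?R = "edge_rel G (H - {\<alpha>})"
    have "D.awalk (head (doubled G) e) p' (tail (doubled G) e)"
      using awalk by (auto simp: p D.awalk_simps)
    moreover have "fst ` set p' \<subseteq> H - {\<alpha>}"
      using dist H by (auto simp: p e rev_image_eqI)
    ultimately have "(head (doubled G) e, tail (doubled G) e) \<in> ?R\<^sup>*"
      by (rule awalk_doubled_imp_edge_rel)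
    then have "(head G \<alpha>, tail G \<alpha>) \<in> ?R\<^sup>*" "(tail G \<alpha>, head G \<alpha>) \<in> ?R\<^sup>*"
      by (auto simp: e split: if_splits dest: edge_rel_rtrancl_sym)
    moreover have "(x, y) \<in> ?R\<^sup>*" if "\<beta> \<in> H - {\<alpha>}"
        "(x, y) = (head G \<beta>, tail G \<beta>) \<or> (x, y) = (tail G \<beta>, head G \<beta>)" for x y \<beta>
      using that by (intro r_into_rtrancl) (auto simp: edge_rel_def)
    ultimately have "edge_rel G H \<subseteq> ?R\<^sup>*"
      by (subst edge_rel_def) blast
    moreover have "?R \<subseteq> edge_rel G H"
      by (rule edge_rel_mono) auto
    ultimately show ?thesis by (metis rtrancl_subset)
  qed
  then show ?thesis using that[of \<alpha>] by (simp add: p e)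
qed

text \<open>An inclusion-minimal connected set of arrows inside \<open>S\<close> has no cycle, since
  some arrow of a cycle could be removed without losing connectedness.\<close>

lemma (in wf_digraph) spanning_tree_exists:
  assumes "finite S" "S \<subseteq> arcs G" "Digraph_Component.connected (G\<lparr>arcs := S\<rparr>)"
  obtains H where "H \<subseteq> S" "is_spanning_tree G H"
proof -
  let ?F = "{H. H \<subseteq> S \<and> Digraph_Component.connected (G\<lparr>arcs := H\<rparr>)}"
  have "finite ?F" using assms(1) by simp
  moreover have "?F \<noteq> {}" using assms(3) by blast
  ultimately have "\<exists>H\<in>?F. \<forall>H'\<in>?F. H' \<subseteq> H \<longrightarrow> H = H'" by (rule finite_has_minimal)
  then obtain H where H: "H \<in> ?F" and min: "\<And>H'. H' \<in> ?F \<Longrightarrow> H' \<subseteq> H \<Longrightarrow> H = H'"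
    by (elim bexE) (metis (lifting))
  have conn_cong: "Digraph_Component.connected (G\<lparr>arcs := H'\<rparr>)"
    if "H' \<subseteq> H" "(edge_rel G H')\<^sup>* = (edge_rel G H)\<^sup>*" for H'
  proof -
    have "H \<subseteq> arcs G" "H' \<subseteq> arcs G" using that(1) H assms(2) by auto
    moreover have "Digraph_Component.connected (G\<lparr>arcs := H\<rparr>)" using H by blast
    ultimately show ?thesis
      unfolding connected_iff_edge_rel[OF wf_digraph_axioms \<open>H \<subseteq> arcs G\<close>]
        connected_iff_edge_rel[OF wf_digraph_axioms \<open>H' \<subseteq> arcs G\<close>] that(2) by blast
  qed
  have "\<not> undirected_cycle (G\<lparr>arcs := H\<rparr>) p" for p
  proof
    have HG: "H \<subseteq> arcs G" using H assms by blast
    assume "undirected_cycle (G\<lparr>arcs := H\<rparr>) p"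
    then have p: "undirected_cycle G p" "fst ` set p \<subseteq> H"
      using undirected_cycle_arcs_update[OF HG] by auto
    obtain \<alpha> where \<alpha>: "\<alpha> \<in> fst ` set p" "(edge_rel G (H - {\<alpha>}))\<^sup>* = (edge_rel G H)\<^sup>*"
      using edge_rel_remove_cycle_arc[OF p(1)] p(2) by metis
    have "H - {\<alpha>} \<in> ?F" using H conn_cong[OF _ \<alpha>(2)] by auto
    then show False using min[of "H - {\<alpha>}"] \<alpha>(1) p(2) by auto
  qed
  then show ?thesis using that[of H] H assms by (auto simp: is_spanning_tree_def)
qed

text \<open>Ratios prescribed along a forest can be integrated arrow by arrow: a new arrow joins two
  different components, as it would otherwise close a cycle, so \<open>g\<close> may be rescaled on
  one of them.\<close>

lemma (in wf_digraph) forest_potential: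
  fixes t :: "'b \<Rightarrow> 'k::field"
  assumes "finite H" "H \<subseteq> arcs G" "\<And>p. undirected_cycle G p \<Longrightarrow> \<not> fst ` set p \<subseteq> H"
    and "\<And>\<alpha>. \<alpha> \<in> H \<Longrightarrow> t \<alpha> \<noteq> 0"
  obtains g :: "'a \<Rightarrow> 'k" where "\<And>v. g v \<noteq> 0" "\<And>\<alpha>. \<alpha> \<in> H \<Longrightarrow> g (head G \<alpha>) = t \<alpha> * g (tail G \<alpha>)"
proof -
  have "\<exists>g :: 'a \<Rightarrow> 'k. (\<forall>v. g v \<noteq> 0) \<and> (\<forall>\<alpha>\<in>H. g (head G \<alpha>) = t \<alpha> * g (tail G \<alpha>))"
    using assms
  proof (induction H rule: finite_induct)
    case empty
    show ?case by (rule exI[of _ "\<lambda>_. 1"]) simp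
  next
    case (insert \<alpha> F)
    then obtain g :: "'a \<Rightarrow> 'k" where g: "\<And>v. g v \<noteq> 0"
      "\<And>\<beta>. \<beta> \<in> F \<Longrightarrow> g (head G \<beta>) = t \<beta> * g (tail G \<beta>)"
      by (metis insert_subset insertCI subset_insertI2)
    \<comment> \<open>\<open>?C\<close> is the component of the head of \<alpha>, and
      \<open>?c\<close> is the factor that forces the equation at \<alpha>. An arrow of
      \<open>F\<close> has both ends in \<open>?C\<close> or none, so its equation survives the
      rescaling.\<close>
    let ?C = "{v. (head G \<alpha>, v) \<in> (edge_rel G F)\<^sup>*}"
    let ?c = "t \<alpha> * g (tail G \<alpha>) / g (head G \<alpha>)"
    let ?g = "\<lambda>v. if v \<in> ?C then ?c * g v else g v"
    have "tail G \<alpha> \<notin> ?C"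
      using undirected_cycle_if_edge_rel[of \<alpha> F] insert.hyps insert.prems by auto
    moreover have "head G \<beta> \<in> ?C \<longleftrightarrow> tail G \<beta> \<in> ?C" if "\<beta> \<in> F" for \<beta>
    proof -
      have "(head G \<beta>, tail G \<beta>) \<in> edge_rel G F" "(tail G \<beta>, head G \<beta>) \<in> edge_rel G F"
        using that by (auto simp: edge_rel_def)
      then show ?thesis by (auto intro: rtrancl_into_rtrancl)
    qed
    ultimately have "\<forall>\<beta>\<in>insert \<alpha> F. ?g (head G \<beta>) = t \<beta> * ?g (tail G \<beta>)"
      using g by auto
    moreover have "\<forall>v. ?g v \<noteq> 0" using g(1) insert.prems by simp
    ultimately show ?case by (intro exI[of _ ?g]) simp
  qed
  then show ?thesis using that by blast
qed


section \<open>Irreducible closed sets and dimension\<close>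

lemma closedin_quotient_topology:
  "closedin (quotient_topology X q) C \<longleftrightarrow>
     C \<subseteq> q ` topspace X \<and> closedin X {x \<in> topspace X. q x \<in> C}"
proof -
  have "closedin X {x \<in> topspace X. q x \<in> C} \<longleftrightarrow> closedin (quotient_topology X q) C"
    if "C \<subseteq> q ` topspace X"
    using quotient_map_quotient_topology[of X q] that
    unfolding quotient_map_closedin topspace_quotient_topology by simp
  then show ?thesis
    using closedin_subset[of "quotient_topology X q" C]
    unfolding topspace_quotient_topology by auto
qed

text \<open>\<open>K\<close> is tested only against closed sets of the whole space, and such a set
  contains \<open>K\<close> exactly if it contains the closure.\<close>

lemma irreducible_closed_closure_of:
  assumes "K \<subseteq> topspace X" "K \<noteq> {}"
    and "\<And>A B. closedin X A \<Longrightarrow> closedin X B \<Longrightarrow> K \<subseteq> A \<union> B \<Longrightarrow> K \<subseteq> A \<or> K \<subseteq> B"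
  shows "irreducible_closed X (X closure_of K)"
  unfolding irreducible_closed_def
proof (intro conjI allI impI)
  show "X closure_of K \<noteq> {}"
    using assms closure_of_subset by blast
  fix A B
  assume AB: "closedin X A \<and> closedin X B \<and> X closure_of K \<subseteq> A \<union> B"
  then have "K \<subseteq> A \<or> K \<subseteq> B"
    using assms closure_of_subset by (metis subset_trans)
  then show "X closure_of K \<subseteq> A \<or> X closure_of K \<subseteq> B"
    using AB closure_of_minimal by metis
qed simp

section \<open>Criteria for dimension 0, 1 and at least 2\<close>

lemma krull_dim_leI:
  assumes "\<And>n Z. \<forall>i\<le>n. irreducible_closed X (Z i) \<Longrightarrow> \<forall>i<n. Z i \<subset> Z (Suc i) \<Longrightarrow> n \<le> m"
  shows "krull_dim X \<le> enat m"
  unfolding krull_dim_def by (rule Sup_least) (use assms in auto)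

lemma krull_dim_geI:
  assumes "\<forall>i\<le>n. irreducible_closed X (Z i)" "\<forall>i<n. Z i \<subset> Z (Suc i)"
  shows "enat n \<le> krull_dim X"
  unfolding krull_dim_def by (rule Sup_upper) (use assms in auto)

lemma krull_dim_singleton:
  assumes "topspace X \<subseteq> {x}"
  shows "krull_dim X = 0"
proof -
  have "n \<le> 0" if Z: "\<forall>i\<le>n. irreducible_closed X (Z i)" "\<forall>i<n. Z i \<subset> Z (Suc i)"
    for n and Z :: "nat \<Rightarrow> 'a set"
  proof (rule ccontr)
    assume "\<not> n \<le> 0"
    then have irr: "irreducible_closed X (Z 0)" "irreducible_closed X (Z 1)" and sub: "Z 0 \<subset> Z 1"
      using Z by auto
    have "Z 1 \<subseteq> {x}"
      using irr(2) assms closedin_subset[of X "Z 1"] by (auto simp: irreducible_closed_def)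
    moreover have "Z 0 \<noteq> {}"
      using irr(1) by (simp add: irreducible_closed_def)
    ultimately show False using sub by blast
  qed
  then have "krull_dim X \<le> enat 0" by (rule krull_dim_leI)
  then show ?thesis by (simp flip: zero_enat_def)
qed

text \<open>The irreducible closed sets are the points and the whole space: an infinite set is not a
  union of two finite ones, while a finite set with several points splits into one point and the
  rest.\<close>

lemma krull_dim_cofinite:
  assumes inf: "infinite (topspace X)"
    and point: "\<And>x. x \<in> topspace X \<Longrightarrow> closedin X {x}"
    and closed: "\<And>A. closedin X A \<Longrightarrow> finite A \<or> A = topspace X"
  shows "krull_dim X = 1"
proof -
  obtain x where x: "x \<in> topspace X"
    using inf by (metis finite.emptyI ex_in_conv)
  have "irreducible_closed X {x}"
    using point[OF x] by (auto simp: irreducible_closed_def)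
  moreover have "irreducible_closed X (topspace X)"
    unfolding irreducible_closed_def
  proof (intro conjI allI impI)
    fix A B
    assume AB: "closedin X A \<and> closedin X B \<and> topspace X \<subseteq> A \<union> B"
    then have "infinite A \<or> infinite B"
      using inf by (meson finite_UnI finite_subset)
    then show "topspace X \<subseteq> A \<or> topspace X \<subseteq> B"
      using AB closed by blast
  qed (use x in auto)
  moreover have "{x} \<subset> topspace X"
    using x inf by (metis finite.emptyI finite_insert psubsetI empty_subsetI insert_subset)
  ultimately have "enat 1 \<le> krull_dim X"
    by (intro krull_dim_geI[of _ _ "\<lambda>i. if i = 0 then {x} else topspace X"]) auto
  moreover have "n \<le> 1" if Z: "\<forall>i\<le>n. irreducible_closed X (Z i)" "\<forall>i<n. Z i \<subset> Z (Suc i)"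
    for n and Z :: "nat \<Rightarrow> 'a set"
  proof (rule ccontr)
    assume "\<not> n \<le> 1"
    then have irr: "irreducible_closed X (Z 0)" "irreducible_closed X (Z 1)" "irreducible_closed X (Z 2)"
      and sub: "Z 0 \<subset> Z 1" "Z 1 \<subset> Z 2"
      using Z(1) Z(2)[rule_format, of 0] Z(2)[rule_format, of 1]
      by (auto simp: numeral_2_eq_2)
    have "Z 2 \<subseteq> topspace X"
      using irr(3) closedin_subset unfolding irreducible_closed_def by blast
    then have fin: "finite (Z 1)" "Z 1 \<subseteq> topspace X"
      using closed[of "Z 1"] irr(2) sub(2) unfolding irreducible_closed_def by auto
    obtain y where y: "y \<in> Z 0"
      using irr(1) unfolding irreducible_closed_def by blast
    have "closedin X (\<Union>z\<in>Z 1 - {y}. {z})"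
      using fin by (intro closedin_Union) (auto intro: point)
    then have "closedin X (Z 1 - {y})" by simp
    moreover have "closedin X {y}" using point y sub(1) fin(2) by blast
    ultimately have "Z 1 \<subseteq> {y} \<or> Z 1 \<subseteq> Z 1 - {y}"
      using irr(2) unfolding irreducible_closed_def by blast
    then show False using y sub(1) by blast
  qed
  then have "krull_dim X \<le> enat 1" by (rule krull_dim_leI)
  ultimately show ?thesis by (simp add: one_enat_def)
qed

lemma two_le_krull_dim:
  assumes irr: "irreducible_closed X A" "irreducible_closed X B" "irreducible_closed X C"
    and sub: "A \<subset> B" "B \<subset> C"
  shows "2 \<le> krull_dim X"
proof -
  have "enat 2 \<le> krull_dim X"
    by (rule krull_dim_geI[of _ _ "\<lambda>i. if i = 0 then A else if i = 1 then B else C"])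
      (use assms in auto)
  then show ?thesis by (simp add: numeral_eq_enat)
qed

section \<open>Closed subsets of lines and planes\<close>

lemma infinite_UNIV_alg_closed_field: "infinite (UNIV :: 'k::alg_closed_field set)"
proof
  assume fin: "finite (UNIV :: 'k set)"
  \<comment> \<open>Over a finite field \<open>?p\<close> vanishes everywhere, so
    \<open>?p + 1\<close> is non-constant without a root.\<close>
  let ?p = "\<Prod>a\<in>(UNIV :: 'k set). [:- a, 1:]"
  have "degree ?p = card (UNIV :: 'k set)"
    by (subst degree_prod_eq_sum_degree) auto
  then have "0 < degree ?p"
    using fin by (simp add: card_gt_0_iff)
  then have "0 < degree (?p + 1)"
    by (subst degree_add_eq_left) auto
  then obtain x where "poly (?p + 1) x = 0"
    using alg_closed_imp_poly_has_root by blast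
  moreover have "poly ?p x = 0"
    using fin by (simp add: poly_prod prod_zero_iff)
  ultimately show False by simp
qed

lemma poly_fun_fun_upd:
  assumes "f \<in> poly_fun I"
  obtains p where "\<And>t. f (x(\<alpha> := t)) = poly p t"
proof -
  have "\<exists>p. \<forall>t. f (x(\<alpha> := t)) = poly p t"
    using assms
  proof induction
    case (const c)
    show ?case by (rule exI[of _ "[:c:]"]) simp
  next
    case (coord i)
    show ?case by (rule exI[of _ "if i = \<alpha> then [:0, 1:] else [:x i:]"]) simp
  next
    case (add f g)
    then show ?case by (metis poly_add)
  next
    case (mult f g)
    then show ?case by (metis poly_mult)
  qed
  then show ?thesis using that by blast
qed

text \<open>Each defining equation restricts to a polynomial in one variable, which is zero or has
  finitely many roots.\<close>

lemma closedin_zariski_line: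
  fixes x :: "'i \<Rightarrow> 'k::field"
  assumes "closedin (zariski I) Z" "x \<in> I \<rightarrow>\<^sub>E UNIV" "\<alpha> \<in> I"
  shows "finite {t. x(\<alpha> := t) \<in> Z} \<or> {t. x(\<alpha> := t) \<in> Z} = UNIV"
proof -
  obtain S where S: "S \<subseteq> poly_fun I" "Z = {x \<in> I \<rightarrow>\<^sub>E UNIV. \<forall>f\<in>S. f x = (0::'k)}"
    using assms(1) unfolding closedin_zariski by blast
  have x: "x(\<alpha> := t) \<in> I \<rightarrow>\<^sub>E UNIV" for t
    using assms(2,3) by (auto simp: PiE_def extensional_def)
  show ?thesis
  proof (cases "\<exists>f\<in>S. \<exists>t. f (x(\<alpha> := t)) \<noteq> 0")
    case True
    then obtain f t where f: "f \<in> S" "f (x(\<alpha> := t)) \<noteq> 0" by blast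
    obtain p where p: "\<And>t. f (x(\<alpha> := t)) = poly p t"
      using poly_fun_fun_upd[of f I x \<alpha>] f S by blast
    have "p \<noteq> 0" using p f by auto
    moreover have "{t. x(\<alpha> := t) \<in> Z} \<subseteq> {t. poly p t = 0}"
      using f p S by auto
    ultimately show ?thesis
      using poly_roots_finite finite_subset by blast
  next
    case False
    then show ?thesis using x S by auto
  qed
qed

text \<open>Two finite sets cannot cover the infinite set of nonzero scalars. \<open>P\<close>
  stands for closedness, of which nothing else is used than this dichotomy on the line.\<close>

lemma irreducible_punctured_line:
  fixes c :: "'k::alg_closed_field \<Rightarrow> 'x"
  assumes line: "\<And>A. P A \<Longrightarrow> finite {t. t \<noteq> 0 \<and> c t \<in> A} \<or> c ` (- {0}) \<subseteq> A"
    and "P A" "P B" "c ` (- {0}) \<subseteq> A \<union> B"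
  shows "c ` (- {0}) \<subseteq> A \<or> c ` (- {0}) \<subseteq> B"
proof (rule ccontr)
  assume "\<not> ?thesis"
  then have "finite ({t. t \<noteq> 0 \<and> c t \<in> A} \<union> {t. t \<noteq> 0 \<and> c t \<in> B})"
    using line assms(2,3) by blast
  moreover have "- {0} \<subseteq> {t. t \<noteq> 0 \<and> c t \<in> A} \<union> {t. t \<noteq> 0 \<and> c t \<in> B}"
    using assms(4) by blast
  ultimately have "finite (- {0 :: 'k})" by (rule rev_finite_subset)
  then show False using infinite_UNIV_alg_closed_field[where 'k = 'k] by simp
qed

text \<open>Each line with fixed \<open>s\<close> lies in \<open>A\<close> or in \<open>B\<close>.
  One of the two receives infinitely many \<open>s\<close>; it then meets every line with fixed
  \<open>t\<close> infinitely often and so contains it.\<close>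

lemma irreducible_punctured_plane:
  fixes c :: "'k::alg_closed_field \<Rightarrow> 'k \<Rightarrow> 'x"
  assumes line1: "\<And>A t. P A \<Longrightarrow> t \<noteq> 0 \<Longrightarrow>
      finite {s. s \<noteq> 0 \<and> c s t \<in> A} \<or> (\<forall>s. s \<noteq> 0 \<longrightarrow> c s t \<in> A)"
    and line2: "\<And>A s. P A \<Longrightarrow> s \<noteq> 0 \<Longrightarrow>
      finite {t. t \<noteq> 0 \<and> c s t \<in> A} \<or> (\<forall>t. t \<noteq> 0 \<longrightarrow> c s t \<in> A)"
    and "P A" "P B" and cover: "\<And>s t. s \<noteq> 0 \<Longrightarrow> t \<noteq> 0 \<Longrightarrow> c s t \<in> A \<union> B"
  shows "(\<forall>s t. s \<noteq> 0 \<longrightarrow> t \<noteq> 0 \<longrightarrow> c s t \<in> A) \<or> (\<forall>s t. s \<noteq> 0 \<longrightarrow> t \<noteq> 0 \<longrightarrow> c s t \<in> B)"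
proof -
  let ?S = "\<lambda>A. {s. s \<noteq> 0 \<and> (\<forall>t. t \<noteq> 0 \<longrightarrow> c s t \<in> A)}"
  have "s \<in> ?S A \<union> ?S B" if "s \<noteq> 0" for s
  proof -
    have "c s ` (- {0}) \<subseteq> A \<or> c s ` (- {0}) \<subseteq> B"
    proof (rule irreducible_punctured_line[of P])
      show "finite {t. t \<noteq> 0 \<and> c s t \<in> A'} \<or> c s ` (- {0}) \<subseteq> A'" if "P A'" for A'
        using line2[OF that \<open>s \<noteq> 0\<close>] by auto
      show "c s ` (- {0}) \<subseteq> A \<union> B" using cover that by auto
    qed fact+
    then show ?thesis using that by auto
  qed
  then have "- {0} \<subseteq> ?S A \<union> ?S B" by blast
  moreover have "infinite (- {0 :: 'k})"
    using infinite_UNIV_alg_closed_field[where 'k = 'k] by simp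
  ultimately have inf: "infinite (?S A) \<or> infinite (?S B)"
    using infinite_super by blast
  have all: "c s t \<in> A'" if "P A'" "infinite (?S A')" "s \<noteq> 0" "t \<noteq> 0" for A' s t
  proof -
    have "?S A' \<subseteq> {s. s \<noteq> 0 \<and> c s t \<in> A'}" using that(4) by blast
    then have "infinite {s. s \<noteq> 0 \<and> c s t \<in> A'}" using that(2) infinite_super by blast
    then show ?thesis using line1[OF that(1,4)] that(3) by blast
  qed
  show ?thesis using inf all[OF \<open>P A\<close>] all[OF \<open>P B\<close>] by blast
qed


section \<open>Stability of representations of dimension vector one\<close>

text \<open>A subspace is stable under the inverse of a nonzero scalar, so only the vanishing of
  \<open>M \<alpha>\<close> matters. This makes stability a property of the support.\<close>

lemma (in wf_digraph) subrep_iff_supp: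
  "subrep G M U \<longleftrightarrow> (\<forall>i\<in>verts G. vector_space_over_itself.subspace (U i))
     \<and> (\<forall>\<alpha>\<in>supp G M. U (tail G \<alpha>) \<subseteq> U (head G \<alpha>))"
proof -
  have "(\<lambda>x. M \<alpha> * x) ` U (tail G \<alpha>) \<subseteq> U (head G \<alpha>) \<longleftrightarrow> M \<alpha> = 0 \<or> U (tail G \<alpha>) \<subseteq> U (head G \<alpha>)"
    if "\<forall>i\<in>verts G. vector_space_over_itself.subspace (U i)" "\<alpha> \<in> arcs G" for \<alpha>
  proof -
    have tail: "vector_space_over_itself.subspace (U (tail G \<alpha>))"
      and head: "vector_space_over_itself.subspace (U (head G \<alpha>))"
      using that by auto
    have "U (tail G \<alpha>) \<subseteq> U (head G \<alpha>)"
      if img: "(\<lambda>x. M \<alpha> * x) ` U (tail G \<alpha>) \<subseteq> U (head G \<alpha>)" and "M \<alpha> \<noteq> 0"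
    proof
      fix x assume "x \<in> U (tail G \<alpha>)"
      then have "M \<alpha> * (inverse (M \<alpha>) * x) \<in> U (head G \<alpha>)"
        using img vector_space_over_itself.subspace_scale[OF tail] by blast
      then show "x \<in> U (head G \<alpha>)" using \<open>M \<alpha> \<noteq> 0\<close> by (simp flip: mult.assoc)
    qed
    then show ?thesis
      using vector_space_over_itself.subspace_scale[OF tail] vector_space_over_itself.subspace_0[OF head]
      by auto
  qed
  then show ?thesis
    unfolding subrep_def supp_def by blast
qed

lemma (in wf_digraph) stable_cong_supp:
  fixes M N :: "'b \<Rightarrow> 'k::field"
  assumes "supp G N = supp G M"
  shows "stable G \<theta> N \<longleftrightarrow> stable G \<theta> M"
  by (simp only: stable_def subrep_iff_supp assms)

lemma supp_rep_of_arrows: "\<Omega> \<subseteq> arcs Q \<Longrightarrow> supp Q (rep_of_arrows Q \<Omega> :: 'a \<Rightarrow> 'k::field) = \<Omega>"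
  by (auto simp: supp_def rep_of_arrows_def)

text \<open>The test object is the subrepresentation that is everything over \<open>C\<close> and
  zero elsewhere; its slope inequality is multiplied by the positive cardinalities to become one of
  integers.\<close>

lemma (in fin_digraph) stable_closed_subset:
  fixes M :: "'b \<Rightarrow> 'k::field"
  assumes "stable G \<theta> M" "C \<subseteq> verts G" "C \<noteq> {}" "C \<noteq> verts G"
    and "\<And>\<alpha>. \<alpha> \<in> supp G M \<Longrightarrow> tail G \<alpha> \<in> C \<Longrightarrow> head G \<alpha> \<in> C"
  shows "\<theta> (\<lambda>i\<in>verts G. if i \<in> C then 1 else 0) * int (card (verts G)) < \<theta> (ones G) * int (card C)"
proof -
  define U :: "'a \<Rightarrow> 'k set" where "U i = (if i \<in> C then UNIV else {0})" for i
  have "subrep G M U"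
    unfolding subrep_iff_supp using assms(5)
    by (auto simp: U_def vector_space_over_itself.subspace_single_0)
  moreover have "nonzero_proper G U"
  proof -
    obtain i j where "i \<in> C" "j \<in> verts G - C" using assms(2-4) by blast
    moreover have "(UNIV :: 'k set) \<noteq> {0}" by (metis UNIV_I singletonD zero_neq_one)
    ultimately show ?thesis using assms(2) unfolding nonzero_proper_def U_def by auto
  qed
  ultimately have less: "slope G \<theta> (dim_vec G U) < slope G \<theta> (ones G)"
    using assms(1) unfolding stable_def by blast
  have dim: "dim_vec G U = (\<lambda>i\<in>verts G. if i \<in> C then 1 else 0)"
    by (auto simp: dim_vec_def U_def fun_eq_iff vector_space_over_itself.dim_UNIV)
  have "(\<Sum>i\<in>verts G. (\<lambda>i\<in>verts G. if i \<in> C then 1 else 0 :: int) i) = int (card C)"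
    using assms(2) finite_verts by (simp add: sum.If_cases Int_absorb1)
  moreover have "(\<Sum>i\<in>verts G. ones G i) = int (card (verts G))"
    by (simp add: ones_def)
  moreover have "card C > 0" "card (verts G) > 0"
    using assms(2,3) finite_subset[OF assms(2) finite_verts] by (auto simp: card_gt_0_iff)
  ultimately have "(of_int (\<theta> (dim_vec G U) * int (card (verts G))) :: rat)
      < of_int (\<theta> (ones G) * int (card C))"
    using less by (simp add: slope_def dim field_simps)
  then show ?thesis unfolding of_int_less_iff dim .
qed

text \<open>A union of connected components and its complement both carry subrepresentations, and their
  slopes cannot both be smaller than the slope of the whole representation.\<close>

lemma (in fin_digraph) connected_supp_if_stable:
  fixes M :: "'b \<Rightarrow> 'k::field"
  assumes "stable G \<theta> M" "stability_condition G \<theta>" "verts G \<noteq> {}"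
  shows "Digraph_Component.connected (G\<lparr>arcs := supp G M\<rparr>)"
proof -
  let ?R = "edge_rel G (supp G M)"
  have "(u, v) \<in> ?R\<^sup>*" if uv: "u \<in> verts G" "v \<in> verts G" for u v
  proof (rule ccontr)
    assume not: "(u, v) \<notin> ?R\<^sup>*"
    define C where "C = {w \<in> verts G. (u, w) \<in> ?R\<^sup>*}"
    let ?\<chi> = "\<lambda>C. \<lambda>i\<in>verts G. if i \<in> C then 1 else 0 :: int"
    have C: "C \<subseteq> verts G" "u \<in> C" "v \<notin> C"
      using uv not by (auto simp: C_def)
    have iff: "head G \<alpha> \<in> C \<longleftrightarrow> tail G \<alpha> \<in> C" if "\<alpha> \<in> supp G M" for \<alpha>
    proof -
      have "(head G \<alpha>, tail G \<alpha>) \<in> ?R" "(tail G \<alpha>, head G \<alpha>) \<in> ?R" "\<alpha> \<in> arcs G"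
        using that by (auto simp: edge_rel_def supp_def)
      then show ?thesis by (auto simp: C_def intro: rtrancl_into_rtrancl)
    qed
    have 1: "\<theta> (?\<chi> C) * int (card (verts G)) < \<theta> (ones G) * int (card C)"
      by (rule stable_closed_subset[OF assms(1)]) (use C uv iff in auto)
    have 2: "\<theta> (?\<chi> (verts G - C)) * int (card (verts G)) < \<theta> (ones G) * int (card (verts G - C))"
      by (rule stable_closed_subset[OF assms(1)]) (use C uv iff in \<open>auto simp: supp_def\<close>)
    have ones: "ones G = (\<lambda>i\<in>verts G. ?\<chi> C i + ?\<chi> (verts G - C) i)"
      by (auto simp: ones_def fun_eq_iff)
    have add: "\<theta> (\<lambda>i\<in>verts G. d i + e i) = \<theta> d + \<theta> e"
      if "d \<in> verts G \<rightarrow>\<^sub>E UNIV" "e \<in> verts G \<rightarrow>\<^sub>E UNIV" for d e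
      using assms(2) that unfolding stability_condition_def by blast
    have sum: "\<theta> (ones G) = \<theta> (?\<chi> C) + \<theta> (?\<chi> (verts G - C))"
      unfolding ones by (rule add) auto
    have "card C + card (verts G - C) = card (verts G)"
      using C(1) finite_verts by (metis card_Diff_subset card_mono finite_subset le_add_diff_inverse)
    then have "int (card (verts G)) = int (card C) + int (card (verts G - C))" by simp
    \<comment> \<open>Added up, 1 and 2 say that \<theta> of \<open>ones G\<close> times the number
      of vertices is less than itself.\<close>
    then show False using 1 2 sum by (simp add: algebra_simps)
  qed
  moreover have "supp G M \<subseteq> arcs G" by (auto simp: supp_def)
  ultimately show ?thesis
    using assms(3) by (simp add: connected_iff_edge_rel[OF wf_digraph_axioms])
qed


section \<open>Orbits and their invariants\<close>

lemma torus_carrier_nonzero: "g \<in> carrier (torus I) \<Longrightarrow> i \<in> I \<Longrightarrow> g i \<noteq> 0"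
  by (auto simp: torus_def)

lemma rep_space_fun_upd: "N \<in> rep_space Q \<Longrightarrow> \<alpha> \<in> arcs Q \<Longrightarrow> N(\<alpha> := t) \<in> rep_space Q"
  by (auto simp: rep_space_def PiE_def extensional_def)

lemma supp_fun_upd: "\<alpha> \<in> supp Q N \<Longrightarrow> t \<noteq> 0 \<Longrightarrow> supp Q (N(\<alpha> := t)) = supp Q N"
  by (auto simp: supp_def)

lemma (in wf_digraph) G_act_in_rep_space: "G_act G g N \<in> rep_space G"
  by (simp add: G_act_def rep_space_def)

lemma (in wf_digraph) supp_G_act:
  "g \<in> carrier (torus (verts G)) \<Longrightarrow> supp G (G_act G g N) = supp G N"
  by (auto simp: supp_def G_act_def torus_carrier_nonzero)

text \<open>One inclusion is proved for every group element; applied to the inverse of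
  \<open>g\<close> it yields the other.\<close>

lemma (in wf_digraph) PG_orbit_G_act:
  fixes N :: "'b \<Rightarrow> 'k::field"
  assumes "N \<in> rep_space G" "g \<in> carrier (torus (verts G))"
  shows "PG_orbit G (G_act G g N) = PG_orbit G N"
proof -
  have sub: "PG_orbit G (G_act G h L) \<subseteq> PG_orbit G L"
    if h: "h \<in> carrier (torus (verts G))" for h :: "'a \<Rightarrow> 'k" and L
  proof
    fix K assume "K \<in> PG_orbit G (G_act G h L)"
    then obtain k where k: "k \<in> carrier (torus (verts G))" "K = G_act G k (G_act G h L)"
      by (auto simp: PG_orbit_eq[OF wf_digraph_axioms])
    have "K = G_act G (\<lambda>i\<in>verts G. k i * h i) L"
      unfolding k(2) by (auto simp: G_act_def fun_eq_iff)
    moreover have "(\<lambda>i\<in>verts G. k i * h i) \<in> carrier (torus (verts G))"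
      using h k(1) by (auto simp: torus_def)
    ultimately show "K \<in> PG_orbit G L"
      by (auto simp: PG_orbit_eq[OF wf_digraph_axioms])
  qed
  have "(\<lambda>i\<in>verts G. inverse (g i)) \<in> carrier (torus (verts G))"
    using assms(2) by (auto simp: torus_def)
  moreover have "G_act G (\<lambda>i\<in>verts G. inverse (g i)) (G_act G g N) = N"
  proof
    fix \<alpha>
    show "G_act G (\<lambda>i\<in>verts G. inverse (g i)) (G_act G g N) \<alpha> = N \<alpha>"
      using assms(1) torus_carrier_nonzero[OF assms(2), of "head G \<alpha>"]
        torus_carrier_nonzero[OF assms(2), of "tail G \<alpha>"]
      by (cases "\<alpha> \<in> arcs G") (auto simp: G_act_def rep_space_def PiE_def extensional_def field_simps)
  qed
  ultimately have "PG_orbit G N \<subseteq> PG_orbit G (G_act G g N)"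
    using sub by metis
  then show ?thesis using sub[OF assms(2)] by blast
qed

lemma (in wf_digraph) PG_orbit_self:
  assumes "N \<in> rep_space G"
  shows "N \<in> PG_orbit G N"
proof -
  have "G_act G (\<lambda>i\<in>verts G. 1) N = N"
    using assms by (auto simp: G_act_def fun_eq_iff rep_space_def PiE_def extensional_def)
  moreover have "(\<lambda>i\<in>verts G. 1) \<in> carrier (torus (verts G))" by (auto simp: torus_def)
  ultimately show ?thesis
    unfolding PG_orbit_eq[OF wf_digraph_axioms] by (metis (mono_tags, lifting) mem_Collect_eq)
qed

text \<open>A potential for the ratios \<open>M \<beta> / N \<beta>\<close> on the tree is a group
  element that carries the values of \<open>N\<close> on \<open>H\<close> to those of
  \<open>M\<close>.\<close>

lemma (in wf_digraph) PG_orbit_normalise_tree: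
  fixes M N :: "'b \<Rightarrow> 'k::field"
  assumes "is_spanning_tree G H" "finite H" "H \<subseteq> supp G M"
    and N: "N \<in> rep_space G" "supp G N = supp G M"
  obtains N' where "N' \<in> rep_space G" "supp G N' = supp G M" "PG_orbit G N' = PG_orbit G N"
    "\<forall>\<beta>\<in>H. N' \<beta> = M \<beta>"
proof -
  have H: "H \<subseteq> arcs G" "\<And>p. undirected_cycle G p \<Longrightarrow> \<not> fst ` set p \<subseteq> H"
    using assms(1) undirected_cycle_arcs_update[of H G] by (auto simp: is_spanning_tree_def)
  have nz: "M \<beta> \<noteq> 0" "N \<beta> \<noteq> 0" if "\<beta> \<in> H" for \<beta>
    using that assms(3) N(2) by (auto simp: supp_def)
  obtain g :: "'a \<Rightarrow> 'k" where g: "\<And>v. g v \<noteq> 0"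
    "\<And>\<beta>. \<beta> \<in> H \<Longrightarrow> g (head G \<beta>) = M \<beta> / N \<beta> * g (tail G \<beta>)"
    using forest_potential[of H "\<lambda>\<beta>. M \<beta> / N \<beta>"] H nz assms(2)
    by (metis divide_eq_0_iff)
  let ?g = "restrict g (verts G)"
  have T: "?g \<in> carrier (torus (verts G))" using g(1) by (auto simp: torus_def)
  have "G_act G ?g N \<beta> = M \<beta>" if "\<beta> \<in> H" for \<beta>
  proof -
    have "\<beta> \<in> arcs G" using that H(1) by blast
    then have "G_act G ?g N \<beta> = g (head G \<beta>) * inverse (g (tail G \<beta>)) * N \<beta>"
      by (simp add: G_act_def)
    then show ?thesis using g(1)[of "tail G \<beta>"] g(2)[OF that] nz[OF that] by (simp add: field_simps)
  qed
  then show ?thesis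
    using that[of "G_act G ?g N"] G_act_in_rep_space supp_G_act[OF T] PG_orbit_G_act[OF N(1) T] N(2)
    by blast
qed

text \<open>The monomials \<open>P\<close> and \<open>R\<close> collect the arrows which an undirected walk from \<open>u\<close> to \<open>v\<close>
  traverses forwards and backwards; \<open>P / R\<close> has weight \<open>g\<^sub>v / g\<^sub>u\<close>.\<close>

lemma (in wf_digraph) walk_monomials:
  fixes H :: "'b set"
  assumes "(u, v) \<in> (edge_rel G H)\<^sup>*" "H \<subseteq> arcs G"
  obtains P R :: "('b \<Rightarrow> 'k::field) \<Rightarrow> 'k"
  where "P \<in> poly_fun (arcs G)" "R \<in> poly_fun (arcs G)"
    and "\<forall>N. (\<forall>\<beta>\<in>H. N \<beta> \<noteq> 0) \<longrightarrow> P N \<noteq> 0 \<and> R N \<noteq> 0"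
    and "\<forall>N N'. (\<forall>\<beta>\<in>H. N \<beta> = N' \<beta>) \<longrightarrow> P N = P N' \<and> R N = R N'"
    and "\<forall>g\<in>carrier (torus (verts G)). \<exists>m m'. m \<noteq> 0 \<and> m' \<noteq> 0 \<and> m * g u = g v * m' \<and>
      (\<forall>N. P (G_act G g N) = m * P N \<and> R (G_act G g N) = m' * R N)"
proof -
  \<comment> \<open>Numerator and denominator are carried separately because \<open>poly_fun\<close>
    has no division; for the same reason the weight \<open>m / m' = g v / g u\<close> appears
    multiplied out. The induction moves the end \<open>v\<close> of the walk.\<close>
  let ?inv = "\<lambda>v P R. P \<in> poly_fun (arcs G) \<and> R \<in> poly_fun (arcs G) \<and>
    (\<forall>N. (\<forall>\<beta>\<in>H. N \<beta> \<noteq> 0) \<longrightarrow> P N \<noteq> 0 \<and> R N \<noteq> 0) \<and>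
    (\<forall>N N'. (\<forall>\<beta>\<in>H. N \<beta> = N' \<beta>) \<longrightarrow> P N = P N' \<and> R N = R N') \<and>
    (\<forall>g\<in>carrier (torus (verts G)). \<exists>m m'. m \<noteq> 0 \<and> m' \<noteq> 0 \<and> m * g u = g v * m' \<and>
      (\<forall>N. P (G_act G g N) = m * P N \<and> R (G_act G g N) = m' * (R N :: 'k)))"
  have "\<exists>P R. ?inv v P R"
    using assms(1)
  proof (induction rule: rtrancl_induct)
    case base
    have "?inv u (\<lambda>_. 1) (\<lambda>_. 1)"
      by (auto intro: poly_fun.const intro!: exI[of _ 1])
    then show ?case by blast
  next
    case (step v w)
    then obtain P R where "?inv v P R" by blast
    then have PR: "P \<in> poly_fun (arcs G)" "R \<in> poly_fun (arcs G)"
      "\<And>N. \<forall>\<beta>\<in>H. N \<beta> \<noteq> 0 \<Longrightarrow> P N \<noteq> 0 \<and> R N \<noteq> 0"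
      "\<And>N N'. \<forall>\<beta>\<in>H. N \<beta> = N' \<beta> \<Longrightarrow> P N = P N' \<and> R N = R N'"
      "\<And>g. g \<in> carrier (torus (verts G)) \<Longrightarrow> \<exists>m m'. m \<noteq> 0 \<and> m' \<noteq> 0 \<and> m * g u = g v * m' \<and>
        (\<forall>N. P (G_act G g N) = m * P N \<and> R (G_act G g N) = m' * R N)"
      by simp_all
    obtain \<beta> where \<beta>: "\<beta> \<in> H" "(v, w) = (tail G \<beta>, head G \<beta>) \<or> (v, w) = (head G \<beta>, tail G \<beta>)"
      using step.hyps(2) by (auto simp: edge_rel_def)
    then have \<beta>G: "\<beta> \<in> arcs G" using assms(2) by blast
    have coord: "(\<lambda>N. N \<beta>) \<in> poly_fun (arcs G)" by (rule poly_fun.coord) (rule \<beta>G)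
    from \<beta>(2) show ?case
    proof
      assume vw: "(v, w) = (tail G \<beta>, head G \<beta>)"
      have "\<exists>m m'. m \<noteq> 0 \<and> m' \<noteq> 0 \<and> m * g u = g w * m' \<and>
          (\<forall>N. P (G_act G g N) * G_act G g N \<beta> = m * (P N * N \<beta>) \<and> R (G_act G g N) = m' * R N)"
        if g: "g \<in> carrier (torus (verts G))" for g
      proof -
        obtain m m' where m: "m \<noteq> 0" "m' \<noteq> 0" "m * g u = g v * m'"
          "\<And>N. P (G_act G g N) = m * P N \<and> R (G_act G g N) = m' * R N"
          using PR(5)[OF g] by blast
        have nz: "g v \<noteq> 0" "g w \<noteq> 0"
          using vw \<beta>G torus_carrier_nonzero[OF g] by auto
        have "m * (g w * inverse (g v)) * g u = (m * g u) * (g w * inverse (g v))"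
          by (simp add: algebra_simps)
        also have "\<dots> = g w * m'" using nz unfolding m(3) by (simp add: field_simps)
        finally show ?thesis
          using m nz vw \<beta>G
          by (intro exI[of _ "m * (g w * inverse (g v))"] exI[of _ m']) (auto simp: G_act_def algebra_simps)
      qed
      then have "?inv w (\<lambda>N. P N * N \<beta>) R"
        using PR(1-4) coord \<beta>(1) by (auto intro: poly_fun.mult)
      then show ?case by blast
    next
      assume vw: "(v, w) = (head G \<beta>, tail G \<beta>)"
      have "\<exists>m m'. m \<noteq> 0 \<and> m' \<noteq> 0 \<and> m * g u = g w * m' \<and>
          (\<forall>N. P (G_act G g N) = m * P N \<and> R (G_act G g N) * G_act G g N \<beta> = m' * (R N * N \<beta>))"
        if g: "g \<in> carrier (torus (verts G))" for g
      proof -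
        obtain m m' where m: "m \<noteq> 0" "m' \<noteq> 0" "m * g u = g v * m'"
          "\<And>N. P (G_act G g N) = m * P N \<and> R (G_act G g N) = m' * R N"
          using PR(5)[OF g] by blast
        have nz: "g v \<noteq> 0" "g w \<noteq> 0"
          using vw \<beta>G torus_carrier_nonzero[OF g] by auto
        have "m * g u = g w * (m' * (g v * inverse (g w)))"
          using nz unfolding m(3) by (simp add: field_simps)
        then show ?thesis
          using m nz vw \<beta>G
          by (intro exI[of _ m] exI[of _ "m' * (g v * inverse (g w))"]) (auto simp: G_act_def algebra_simps)
      qed
      then have "?inv w P (\<lambda>N. R N * N \<beta>)"
        using PR(1-4) coord \<beta>(1) by (auto intro: poly_fun.mult)
      then show ?case by blast
    qed
  qed
  then obtain P R where PR: "?inv v P R" by blast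
  show ?thesis
    by (rule that[of P R]) (use PR in blast)+
qed


section \<open>The orbit of a stable representation\<close>

locale stable_representation = fin_digraph Q
  for Q :: "('v, 'a) pre_digraph" and \<theta> :: "('v \<Rightarrow> int) \<Rightarrow> int" and M :: "'a \<Rightarrow> 'k::alg_closed_field" +
  assumes verts_nonempty: "verts Q \<noteq> {}"
    and stability: "stability_condition Q \<theta>"
    and M_stable: "M \<in> stable_locus Q \<theta>"
begin

abbreviation S :: "'a set" where "S \<equiv> supp Q M"

text \<open>This is the \<open>T\<close>-orbit of \<open>M\<close>, described without the
  torus.\<close>

definition same_supp :: "('a \<Rightarrow> 'k) set" where
  "same_supp = {N \<in> rep_space Q. supp Q N = S}"

definition orbit :: "('a \<Rightarrow> 'k) set topology" where
  "orbit = subtopology (moduli_space Q \<theta>) (T0_orbit Q (PG_orbit Q M))"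

lemma supp_arcs: "S \<subseteq> arcs Q" "finite S"
  using finite_arcs by (auto simp: supp_def)

lemma same_supp_stable: "same_supp \<subseteq> stable_locus Q \<theta>"
proof
  fix N assume "N \<in> same_supp"
  then have N: "N \<in> rep_space Q" "supp Q N = S" by (simp_all add: same_supp_def)
  have "stable Q \<theta> M" using M_stable by (simp add: stable_locus_def)
  then show "N \<in> stable_locus Q \<theta>"
    using N(1) stable_cong_supp[OF N(2)] by (simp add: stable_locus_def)
qed

lemma M_same_supp: "M \<in> same_supp"
  using M_stable by (auto simp: same_supp_def stable_locus_def)

lemma same_supp_fun_upd: "N \<in> same_supp \<Longrightarrow> \<alpha> \<in> S \<Longrightarrow> t \<noteq> 0 \<Longrightarrow> N(\<alpha> := t) \<in> same_supp"
  using rep_space_fun_upd[of N Q \<alpha> t] supp_fun_upd[of \<alpha> Q N t] supp_arcs(1)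
  by (auto simp: same_supp_def)

section \<open>The orbit as a topological space and its closed subsets\<close>

lemma topspace_stable_locus:
  "topspace (subtopology (zariski (arcs Q)) (stable_locus Q \<theta> :: ('a \<Rightarrow> 'k) set)) = stable_locus Q \<theta>"
  by (auto simp: topspace_zariski stable_locus_def rep_space_def)

text \<open>By \<open>T0_act_coset\<close> the orbit consists of the classes of all
  \<open>T_act Q t M\<close>, and the torus moves \<open>M\<close> to every representation with the
  same support.\<close>

lemma T0_orbit_eq: "T0_orbit Q (PG_orbit Q M) = PG_orbit Q ` same_supp"
proof -
  have "T0_orbit Q (PG_orbit Q M) = {PG_orbit Q (T_act Q t M) | t. t \<in> carrier (torus (arcs Q))}"
  proof -
    let ?K = "sigma_map Q ` carrier (torus (verts Q) :: ('v \<Rightarrow> 'k) monoid)"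
    have "carrier (T0 Q) = (\<lambda>t. ?K #>\<^bsub>torus (arcs Q)\<^esub> t) ` carrier (torus (arcs Q))"
      unfolding T0_def FactGroup_def RCOSETS_def by simp blast
    then have "T0_orbit Q (PG_orbit Q M)
        = (\<lambda>t. T0_act Q (?K #>\<^bsub>torus (arcs Q)\<^esub> t) (PG_orbit Q M)) ` carrier (torus (arcs Q))"
      unfolding T0_orbit_def Setcompr_eq_image by (simp only: image_image)
    also have "\<dots> = (\<lambda>t. PG_orbit Q (T_act Q t M)) ` carrier (torus (arcs Q))"
      by (rule image_cong) (simp_all add: T0_act_coset[OF wf_digraph_axioms])
    finally show ?thesis unfolding Setcompr_eq_image .
  qed
  also have "\<dots> = PG_orbit Q ` (\<lambda>t. T_act Q t M) ` carrier (torus (arcs Q))"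
    unfolding Setcompr_eq_image image_image ..
  also have "(\<lambda>t. T_act Q t M) ` carrier (torus (arcs Q)) = same_supp"
  proof (intro equalityI subsetI)
    fix N assume "N \<in> (\<lambda>t. T_act Q t M) ` carrier (torus (arcs Q))"
    then show "N \<in> same_supp"
      by (auto simp: T_act_def same_supp_def rep_space_def supp_def torus_carrier_nonzero)
  next
    fix N assume N: "N \<in> same_supp"
    \<comment> \<open>Off the support both values are 0, so any nonzero entry would do
      there.\<close>
    define t where "t = (\<lambda>\<alpha>\<in>arcs Q. if \<alpha> \<in> S then N \<alpha> / M \<alpha> else 1)"
    have nz: "M \<alpha> \<noteq> 0" "N \<alpha> \<noteq> 0" if "\<alpha> \<in> S" for \<alpha>
      using that N by (auto simp: same_supp_def supp_def)
    have "t \<in> carrier (torus (arcs Q))"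
      using nz by (auto simp: torus_def t_def)
    moreover have "N = T_act Q t M"
    proof
      fix \<alpha>
      show "N \<alpha> = T_act Q t M \<alpha>"
      proof (cases "\<alpha> \<in> S")
        case True
        then show ?thesis using nz supp_arcs by (auto simp: T_act_def t_def)
      next
        case False
        then show ?thesis
          using N unfolding same_supp_def rep_space_def T_act_def
          by (cases "\<alpha> \<in> arcs Q") (auto simp: supp_def PiE_def extensional_def)
      qed
    qed
    ultimately show "N \<in> (\<lambda>t. T_act Q t M) ` carrier (torus (arcs Q))" by blast
  qed
  finally show ?thesis .
qed

lemma topspace_orbit: "topspace orbit = PG_orbit Q ` same_supp"
proof -
  have "topspace (moduli_space Q \<theta> :: ('a \<Rightarrow> 'k) set topology) = PG_orbit Q ` stable_locus Q \<theta>"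
    by (simp only: moduli_space_def topspace_quotient_topology topspace_stable_locus)
  then show ?thesis
    unfolding orbit_def topspace_subtopology T0_orbit_eq
    by (simp only:) (rule Int_absorb1, rule image_mono[OF same_supp_stable])
qed

text \<open>On \<open>same_supp\<close>, the preimage of \<open>A\<close> under the quotient map is
  cut out by a Zariski closed set \<open>Z\<close>, to which \<open>closedin_zariski_line\<close>
  applies.\<close>

lemma closedin_orbit_line:
  assumes "closedin orbit A" "N \<in> same_supp" "\<alpha> \<in> S"
  shows "finite {t. t \<noteq> 0 \<and> PG_orbit Q (N(\<alpha> := t)) \<in> A} \<or> (\<forall>t. t \<noteq> 0 \<longrightarrow> PG_orbit Q (N(\<alpha> := t)) \<in> A)"
proof -
  let ?X = "subtopology (zariski (arcs Q)) (stable_locus Q \<theta> :: ('a \<Rightarrow> 'k) set)"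
  obtain C where C: "closedin (moduli_space Q \<theta>) C" "A = C \<inter> T0_orbit Q (PG_orbit Q M)"
    using assms(1) unfolding orbit_def closedin_subtopology by blast
  have "closedin ?X {x \<in> stable_locus Q \<theta>. PG_orbit Q x \<in> C}"
    using C(1) unfolding moduli_space_def closedin_quotient_topology topspace_stable_locus by simp
  then obtain Z where Z: "closedin (zariski (arcs Q)) Z"
    "{x \<in> stable_locus Q \<theta>. PG_orbit Q x \<in> C} = Z \<inter> (stable_locus Q \<theta> :: ('a \<Rightarrow> 'k) set)"
    unfolding closedin_subtopology by blast
  \<comment> \<open>At \<open>t = 0\<close> the arrow \<alpha> would leave the support, so only
    nonzero values stay in \<open>same_supp\<close>.\<close>
  have iff: "PG_orbit Q (N(\<alpha> := t)) \<in> A \<longleftrightarrow> N(\<alpha> := t) \<in> Z" if "t \<noteq> 0" for t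
  proof -
    have "N(\<alpha> := t) \<in> same_supp" by (rule same_supp_fun_upd) fact+
    then show ?thesis
      using Z(2) same_supp_stable unfolding C(2) T0_orbit_eq by blast
  qed
  have "finite {t. N(\<alpha> := t) \<in> Z} \<or> {t. N(\<alpha> := t) \<in> Z} = UNIV"
    using assms(2,3) supp_arcs(1)
    by (intro closedin_zariski_line[OF Z(1)]) (auto simp: same_supp_def rep_space_def)
  then show ?thesis
  proof
    assume "finite {t. N(\<alpha> := t) \<in> Z}"
    moreover have "{t. t \<noteq> 0 \<and> PG_orbit Q (N(\<alpha> := t)) \<in> A} \<subseteq> {t. N(\<alpha> := t) \<in> Z}"
      using iff by blast
    ultimately show ?thesis using finite_subset by blast
  qed (use iff in blast)
qed

text \<open>The closed set is cut out by the equation \<open>\<chi> N = \<chi> N\<^sub>0\<close>, where the \<open>G\<close>-invariant Laurent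
  monomial \<open>\<chi>\<close> belongs to the cycle formed by \<open>\<alpha>\<close> and a walk in \<open>H\<close> from its head to its tail.\<close>

lemma separating_closed_set:
  assumes N0: "N0 \<in> same_supp" and "H \<subseteq> S" "Digraph_Component.connected (Q\<lparr>arcs := H\<rparr>)" "\<alpha> \<in> S"
  obtains D where "closedin orbit D"
    and "\<And>N. N \<in> same_supp \<Longrightarrow> \<forall>\<beta>\<in>H. N \<beta> = N0 \<beta> \<Longrightarrow> PG_orbit Q N \<in> D \<longleftrightarrow> N \<alpha> = N0 \<alpha>"
proof -
  let ?L = "stable_locus Q \<theta> :: ('a \<Rightarrow> 'k) set"
  let ?X = "subtopology (zariski (arcs Q)) ?L"
  have arcs: "H \<subseteq> arcs Q" "\<alpha> \<in> arcs Q"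
    using assms supp_arcs(1) by auto
  then have walk: "(head Q \<alpha>, tail Q \<alpha>) \<in> (edge_rel Q H)\<^sup>*"
    using assms(3) by (simp add: connected_iff_edge_rel[OF wf_digraph_axioms])
  obtain P R :: "('a \<Rightarrow> 'k) \<Rightarrow> 'k"
    where PR: "P \<in> poly_fun (arcs Q)" "R \<in> poly_fun (arcs Q)"
      and nz: "\<forall>N. (\<forall>\<beta>\<in>H. N \<beta> \<noteq> 0) \<longrightarrow> P N \<noteq> 0 \<and> R N \<noteq> 0"
      and agree: "\<forall>N N'. (\<forall>\<beta>\<in>H. N \<beta> = N' \<beta>) \<longrightarrow> P N = P N' \<and> R N = R N'"
      and weight: "\<forall>g\<in>carrier (torus (verts Q)). \<exists>m m'. m \<noteq> 0 \<and> m' \<noteq> 0 \<and> m * g (head Q \<alpha>) = g (tail Q \<alpha>) * m' \<and>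
        (\<forall>N. P (G_act Q g N) = m * P N \<and> R (G_act Q g N) = m' * R N)"
    by (rule walk_monomials[OF walk arcs(1)])
  \<comment> \<open>Here \<chi> is \<open>N \<alpha> * P N / R N\<close>. Denominators are cleared
    so that the equation is polynomial on all of the stable locus, where \<open>R\<close> may
    vanish.\<close>
  define eqn where "eqn N \<longleftrightarrow> N \<alpha> * P N * R N0 = N0 \<alpha> * P N0 * R N" for N
  define D' where "D' = {N \<in> ?L. eqn N}"
  \<comment> \<open>The walk contributes the weight of the tail over that of the head, which cancels
    the weight of the coordinate at \<alpha>.\<close>
  have eqn_G_act: "eqn (G_act Q g N)" if eqn: "eqn N" and g: "g \<in> carrier (torus (verts Q))" for g N
  proof -
    obtain m m' where m: "m * g (head Q \<alpha>) = g (tail Q \<alpha>) * m'"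
      "P (G_act Q g N) = m * P N" "R (G_act Q g N) = m' * R N"
      using bspec[OF weight g] by blast
    have gt: "g (tail Q \<alpha>) \<noteq> 0" using torus_carrier_nonzero[OF g] arcs(2) by simp
    have "G_act Q g N \<alpha> * P (G_act Q g N) * R N0
        = (m * g (head Q \<alpha>)) * inverse (g (tail Q \<alpha>)) * (N \<alpha> * P N * R N0)"
      using arcs(2) m(2) by (simp add: G_act_def algebra_simps)
    also have "\<dots> = m' * (N0 \<alpha> * P N0 * R N)"
      using gt eqn unfolding m(1) eqn_def by simp
    finally show ?thesis using m(3) by (simp add: eqn_def algebra_simps)
  qed
  \<comment> \<open>By invariance \<open>D'\<close> is a union of orbits, hence the full preimage of
    its image; this is what makes the image closed in the quotient.\<close>
  have preimage: "PG_orbit Q N \<in> PG_orbit Q ` D' \<longleftrightarrow> eqn N" if "N \<in> ?L" for N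
  proof
    assume "PG_orbit Q N \<in> PG_orbit Q ` D'"
    then obtain N' where N': "N' \<in> D'" "PG_orbit Q N = PG_orbit Q N'" by blast
    have "N \<in> PG_orbit Q N'"
      using PG_orbit_self[of N] that N'(2) by (simp add: stable_locus_def)
    then show "eqn N"
      using N'(1) eqn_G_act by (auto simp: PG_orbit_eq[OF wf_digraph_axioms] D'_def)
  qed (use that in \<open>auto simp: D'_def\<close>)
  have "closedin ?X D'"
  proof -
    let ?f = "\<lambda>N. N \<alpha> * P N * R N0 + (- 1) * (N0 \<alpha> * P N0 * R N)"
    let ?Z = "{N \<in> arcs Q \<rightarrow>\<^sub>E UNIV. \<forall>f\<in>{?f}. f N = 0}"
    have "?f \<in> poly_fun (arcs Q)"
      by (intro poly_fun.add poly_fun.mult poly_fun.const poly_fun.coord arcs PR)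
    then have "closedin (zariski (arcs Q)) ?Z"
      unfolding closedin_zariski by blast
    moreover have "D' = ?Z \<inter> ?L"
      by (auto simp: D'_def eqn_def stable_locus_def rep_space_def)
    ultimately show ?thesis unfolding closedin_subtopology by blast
  qed
  moreover have "{N \<in> ?L. PG_orbit Q N \<in> PG_orbit Q ` D'} = D'"
    using preimage by (auto simp: D'_def)
  moreover have "PG_orbit Q ` D' \<subseteq> PG_orbit Q ` ?L" by (auto simp: D'_def)
  ultimately have "closedin (moduli_space Q \<theta>) (PG_orbit Q ` D')"
    unfolding moduli_space_def closedin_quotient_topology topspace_stable_locus by simp
  then have "closedin orbit (PG_orbit Q ` D' \<inter> topspace orbit)"
    unfolding topspace_orbit unfolding orbit_def closedin_subtopology T0_orbit_eq
    by (intro exI conjI) (assumption, rule refl)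
  \<comment> \<open>Agreement on \<open>H\<close> makes the values of \<open>P\<close> and
    \<open>R\<close> at \<open>N\<close> and \<open>N0\<close> equal, and they are nonzero, so they
    cancel from the equation.\<close>
  moreover have "PG_orbit Q N \<in> PG_orbit Q ` D' \<inter> topspace orbit \<longleftrightarrow> N \<alpha> = N0 \<alpha>"
    if N: "N \<in> same_supp" and H: "\<forall>\<beta>\<in>H. N \<beta> = N0 \<beta>" for N
  proof -
    have "P N = P N0 \<and> R N = R N0" using agree H by blast
    moreover have "P N0 \<noteq> 0 \<and> R N0 \<noteq> 0"
      using N0 assms(2) by (intro nz[rule_format]) (auto simp: same_supp_def supp_def)
    ultimately have "eqn N \<longleftrightarrow> N \<alpha> = N0 \<alpha>" by (simp add: eqn_def)
    then show ?thesis
      using preimage[of N] N same_supp_stable by (auto simp: topspace_orbit)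
  qed
  ultimately show ?thesis using that by blast
qed

section \<open>Dimension of the orbit\<close>

text \<open>With the tree values fixed by the group, the remaining arrows of the support parametrise
  the orbit.\<close>

lemma normalise:
  assumes "is_spanning_tree Q H" "H \<subseteq> S" "x \<in> topspace orbit"
  obtains N where "N \<in> same_supp" "x = PG_orbit Q N" "\<forall>\<beta>\<in>H. N \<beta> = M \<beta>"
proof -
  obtain N where N: "N \<in> rep_space Q" "supp Q N = S" "x = PG_orbit Q N"
    using assms(3) unfolding topspace_orbit same_supp_def by blast
  have "finite H" using assms(2) supp_arcs(2) by (rule finite_subset)
  then obtain N' where N': "N' \<in> rep_space Q" "supp Q N' = S" "PG_orbit Q N' = PG_orbit Q N"
    "\<forall>\<beta>\<in>H. N' \<beta> = M \<beta>"
    by (rule PG_orbit_normalise_tree[OF assms(1) _ assms(2) N(1,2)])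
  show ?thesis
    by (rule that[of N']) (simp_all add: N' N(3) same_supp_def)
qed

text \<open>Both values are 0 on the arrows outside \<open>S\<close> and \<open>undefined\<close>
  off \<open>arcs Q\<close>, so functions need only be compared on \<open>S\<close>.\<close>

lemma same_supp_outside: "N \<in> same_supp \<Longrightarrow> \<beta> \<notin> S \<Longrightarrow> N \<beta> = M \<beta>"
  using M_same_supp
  by (cases "\<beta> \<in> arcs Q") (auto simp: same_supp_def rep_space_def supp_def PiE_def extensional_def)

lemma krull_dim_orbit_tree:
  assumes "is_spanning_tree Q S"
  shows "krull_dim orbit = 0"
proof (rule krull_dim_singleton)
  show "topspace orbit \<subseteq> {PG_orbit Q M}"
  proof
    fix x assume "x \<in> topspace orbit"
    then obtain N where N: "N \<in> same_supp" "x = PG_orbit Q N" "\<forall>\<beta>\<in>S. N \<beta> = M \<beta>"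
      using normalise[OF assms order_refl] by blast
    have "N = M" using N(1,3) same_supp_outside by blast
    then show "x \<in> {PG_orbit Q M}" using N(2) by simp
  qed
qed

lemma krull_dim_orbit_almost_tree:
  assumes tree: "is_spanning_tree Q (S - {\<alpha>})" and "\<alpha> \<in> S"
  shows "krull_dim orbit = 1"
proof -
  let ?q = "\<lambda>t. PG_orbit Q (M(\<alpha> := t))"
  have top: "topspace orbit = ?q ` (- {0})"
  proof (intro equalityI subsetI)
    fix x assume "x \<in> topspace orbit"
    then obtain N where N: "N \<in> same_supp" "x = PG_orbit Q N" "\<forall>\<beta>\<in>S - {\<alpha>}. N \<beta> = M \<beta>"
      using normalise[OF tree] by blast
    have "N \<beta> = M \<beta>" if "\<beta> \<noteq> \<alpha>" for \<beta>
      using N(3) same_supp_outside[OF N(1), of \<beta>] that by blast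
    then have "N = M(\<alpha> := N \<alpha>)" by (simp add: fun_eq_iff)
    with N(2) have "x = ?q (N \<alpha>)" by metis
    moreover have "N \<alpha> \<noteq> 0" using N(1) \<open>\<alpha> \<in> S\<close> by (auto simp: same_supp_def supp_def)
    ultimately show "x \<in> ?q ` (- {0})" by (intro image_eqI) auto
  qed (use same_supp_fun_upd[OF M_same_supp \<open>\<alpha> \<in> S\<close>] in \<open>auto simp: topspace_orbit\<close>)
  \<comment> \<open>All \<open>M(\<alpha> := t)\<close> share the tree values of \<open>M\<close>,
    so the separating set for \<open>M(\<alpha> := t0)\<close> singles out one parameter. This gives
    both injectivity of \<open>?q\<close> and closed points.\<close>
  have sep: "\<exists>D. closedin orbit D \<and> (\<forall>t. t \<noteq> 0 \<longrightarrow> (?q t \<in> D \<longleftrightarrow> t = t0))" if t0: "t0 \<noteq> 0" for t0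
  proof -
    have conn: "Digraph_Component.connected (Q\<lparr>arcs := S - {\<alpha>}\<rparr>)"
      using tree by (simp add: is_spanning_tree_def)
    obtain D where D: "closedin orbit D" "\<And>N. N \<in> same_supp \<Longrightarrow>
        \<forall>\<beta>\<in>S - {\<alpha>}. N \<beta> = (M(\<alpha> := t0)) \<beta> \<Longrightarrow> PG_orbit Q N \<in> D \<longleftrightarrow> N \<alpha> = (M(\<alpha> := t0)) \<alpha>"
      using separating_closed_set[OF same_supp_fun_upd[OF M_same_supp \<open>\<alpha> \<in> S\<close> t0] Diff_subset conn \<open>\<alpha> \<in> S\<close>]
      by blast
    have "?q t \<in> D \<longleftrightarrow> t = t0" if "t \<noteq> 0" for t
      using D(2)[OF same_supp_fun_upd[OF M_same_supp \<open>\<alpha> \<in> S\<close> that]] by simp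
    then show ?thesis using D(1) by blast
  qed
  show ?thesis
  proof (rule krull_dim_cofinite)
    have "inj_on ?q (- {0})"
    proof (rule inj_onI)
      fix s t assume "s \<in> - {0 :: 'k}" "t \<in> - {0 :: 'k}" "?q s = ?q t"
      then show "s = t" using sep[of s] by (metis ComplD singletonI)
    qed
    then show "infinite (topspace orbit)"
      unfolding top using infinite_UNIV_alg_closed_field[where 'k = 'k] by (simp add: finite_image_iff)
  next
    fix x assume x: "x \<in> topspace orbit"
    then obtain t0 where t0: "t0 \<noteq> 0" "x = ?q t0" unfolding top by blast
    obtain D where D: "closedin orbit D" "\<forall>t. t \<noteq> 0 \<longrightarrow> (?q t \<in> D \<longleftrightarrow> t = t0)"
      using sep[OF t0(1)] by blast
    have "D \<subseteq> ?q ` (- {0})" using closedin_subset[OF D(1)] unfolding top .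
    then have "D = {x}" using D(2) t0 by blast
    then show "closedin orbit {x}" using D(1) by simp
  next
    fix A assume A: "closedin orbit A"
    have sub: "A \<subseteq> ?q ` (- {0})" using closedin_subset[OF A] unfolding top .
    from closedin_orbit_line[OF A M_same_supp \<open>\<alpha> \<in> S\<close>]
    show "finite A \<or> A = topspace orbit"
    proof
      assume "finite {t. t \<noteq> 0 \<and> ?q t \<in> A}"
      then have "finite (?q ` {t. t \<noteq> 0 \<and> ?q t \<in> A})" by (rule finite_imageI)
      moreover have "A \<subseteq> ?q ` {t. t \<noteq> 0 \<and> ?q t \<in> A}" using sub by blast
      ultimately show ?thesis using finite_subset by blast
    next
      assume "\<forall>t. t \<noteq> 0 \<longrightarrow> ?q t \<in> A"
      then show ?thesis using sub unfolding top by blast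
    qed
  qed
qed

lemma two_le_krull_dim_orbit:
  assumes "is_spanning_tree Q H" "H \<subseteq> S" "\<alpha> \<in> S - H" "\<beta> \<in> S - H" "\<alpha> \<noteq> \<beta>"
  shows "2 \<le> krull_dim orbit"
proof -
  let ?q = "\<lambda>s t. PG_orbit Q (M(\<alpha> := s, \<beta> := t))"
  have conn: "Digraph_Component.connected (Q\<lparr>arcs := H\<rparr>)"
    using assms(1) by (simp add: is_spanning_tree_def)
  have \<alpha>: "\<alpha> \<in> S" "\<alpha> \<notin> H" and \<beta>: "\<beta> \<in> S" "\<beta> \<notin> H" using assms by auto
  have in_same_supp: "M(\<alpha> := s, \<beta> := t) \<in> same_supp" if "s \<noteq> 0" "t \<noteq> 0" for s t
    using that \<alpha> \<beta> by (intro same_supp_fun_upd M_same_supp)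
  then have in_top: "?q s t \<in> topspace orbit" if "s \<noteq> 0" "t \<noteq> 0" for s t
    using that by (auto simp: topspace_orbit)
  have agree: "\<forall>\<gamma>\<in>H. (M(\<alpha> := s, \<beta> := t)) \<gamma> = M \<gamma>" for s t
    using \<alpha> \<beta> by auto
  have M0: "M \<alpha> \<noteq> 0" "M \<beta> \<noteq> 0" using \<alpha> \<beta> by (auto simp: supp_def)
  \<comment> \<open>In the coordinates \<open>s\<close>, \<open>t\<close>, the closed sets
    \<open>D\<close> and \<open>E\<close> are the lines \<open>s = M \<alpha>\<close> and
    \<open>t = M \<beta>\<close>.\<close>
  obtain D where D: "closedin orbit D" "\<And>s t. s \<noteq> 0 \<Longrightarrow> t \<noteq> 0 \<Longrightarrow> ?q s t \<in> D \<longleftrightarrow> s = M \<alpha>"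
  proof -
    obtain D where D: "closedin orbit D" "\<And>N. N \<in> same_supp \<Longrightarrow> \<forall>\<gamma>\<in>H. N \<gamma> = M \<gamma> \<Longrightarrow>
        PG_orbit Q N \<in> D \<longleftrightarrow> N \<alpha> = M \<alpha>"
      using separating_closed_set[OF M_same_supp assms(2) conn \<alpha>(1)] by blast
    have "?q s t \<in> D \<longleftrightarrow> s = M \<alpha>" if "s \<noteq> 0" "t \<noteq> 0" for s t
      using D(2)[OF in_same_supp[OF that], OF agree] assms(5) by simp
    then show ?thesis using that D(1) by blast
  qed
  obtain E where E: "closedin orbit E" "\<And>s t. s \<noteq> 0 \<Longrightarrow> t \<noteq> 0 \<Longrightarrow> ?q s t \<in> E \<longleftrightarrow> t = M \<beta>"
  proof -
    obtain E where E: "closedin orbit E" "\<And>N. N \<in> same_supp \<Longrightarrow> \<forall>\<gamma>\<in>H. N \<gamma> = M \<gamma> \<Longrightarrow>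
        PG_orbit Q N \<in> E \<longleftrightarrow> N \<beta> = M \<beta>"
      using separating_closed_set[OF M_same_supp assms(2) conn \<beta>(1)] by blast
    have "?q s t \<in> E \<longleftrightarrow> t = M \<beta>" if "s \<noteq> 0" "t \<noteq> 0" for s t
      using E(2)[OF in_same_supp[OF that], OF agree] assms(5) by simp
    then show ?thesis using that E(1) by blast
  qed
  \<comment> \<open>\<open>closedin_orbit_line\<close> varies the last update, so here the two
    updates are exchanged.\<close>
  have line1: "finite {s. s \<noteq> 0 \<and> ?q s t \<in> A} \<or> (\<forall>s. s \<noteq> 0 \<longrightarrow> ?q s t \<in> A)"
    if "closedin orbit A" "t \<noteq> 0" for A t
    using closedin_orbit_line[OF that(1) same_supp_fun_upd[OF M_same_supp \<beta>(1) that(2)] \<alpha>(1)]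
    by (simp add: fun_upd_twist[OF assms(5)])
  have line2: "finite {t. t \<noteq> 0 \<and> ?q s t \<in> A} \<or> (\<forall>t. t \<noteq> 0 \<longrightarrow> ?q s t \<in> A)"
    if "closedin orbit A" "s \<noteq> 0" for A s
    using closedin_orbit_line[OF that(1) same_supp_fun_upd[OF M_same_supp \<alpha>(1) that(2)] \<beta>(1)] .
  \<comment> \<open>A nonzero value different from both coordinates of \<open>M\<close> serves as
    witness for both strict inclusions.\<close>
  obtain c :: 'k where c: "c \<notin> {0, M \<alpha>, M \<beta>}"
    using ex_new_if_finite[OF infinite_UNIV_alg_closed_field, of "{0, M \<alpha>, M \<beta>}"] by auto
  \<comment> \<open>A point, a punctured line through it and a punctured plane containing the line,
    all in terms of the parameters.\<close>
  define K0 where "K0 = {?q (M \<alpha>) (M \<beta>)}"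
  define K1 where "K1 = (\<lambda>s. ?q s (M \<beta>)) ` (- {0})"
  define K2 where "K2 = {?q s t | s t. s \<noteq> 0 \<and> t \<noteq> 0}"
  let ?cl = "\<lambda>K. orbit closure_of K"
  have "K0 \<subseteq> K1" unfolding K0_def K1_def using M0(1) by blast
  moreover have "K1 \<subseteq> K2" unfolding K1_def K2_def using M0(2) by blast
  moreover have "K2 \<subseteq> topspace orbit" using in_top by (auto simp: K2_def)
  ultimately have K: "K0 \<subseteq> K1" "K1 \<subseteq> K2" "K2 \<subseteq> topspace orbit" .
  show ?thesis
  proof (rule two_le_krull_dim)
    show "irreducible_closed orbit (?cl K0)"
      by (rule irreducible_closed_closure_of) (use K in \<open>auto simp: K0_def\<close>)
    show "irreducible_closed orbit (?cl K1)"
    proof (rule irreducible_closed_closure_of)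
      show "K1 \<subseteq> A \<or> K1 \<subseteq> B" if "closedin orbit A" "closedin orbit B" "K1 \<subseteq> A \<union> B" for A B
        unfolding K1_def
      proof (rule irreducible_punctured_line[of "closedin orbit"])
        show "finite {t. t \<noteq> 0 \<and> ?q t (M \<beta>) \<in> A'} \<or> (\<lambda>s. ?q s (M \<beta>)) ` (- {0}) \<subseteq> A'"
          if "closedin orbit A'" for A'
          using line1[OF that M0(2)] by blast
      qed (use that in \<open>simp_all add: K1_def\<close>)
    qed (use K in \<open>auto simp: K0_def\<close>)
    show "irreducible_closed orbit (?cl K2)"
    proof (rule irreducible_closed_closure_of)
      fix A B assume AB: "closedin orbit A" "closedin orbit B" "K2 \<subseteq> A \<union> B"
      have "(\<forall>s t. s \<noteq> 0 \<longrightarrow> t \<noteq> 0 \<longrightarrow> ?q s t \<in> A) \<or> (\<forall>s t. s \<noteq> 0 \<longrightarrow> t \<noteq> 0 \<longrightarrow> ?q s t \<in> B)"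
      proof (rule irreducible_punctured_plane[of "closedin orbit"])
        show "?q s t \<in> A \<union> B" if "s \<noteq> 0" "t \<noteq> 0" for s t
          using AB(3) that unfolding K2_def by blast
      qed (fact line1 line2 AB)+
      then show "K2 \<subseteq> A \<or> K2 \<subseteq> B" unfolding K2_def by blast
    qed (use K in \<open>auto simp: K0_def\<close>)
    \<comment> \<open>\<open>D\<close> contains the smaller closure but misses the point of
      \<open>K1\<close> with first parameter \<open>c\<close>; the next inclusion is strict by the
      same argument with \<open>E\<close> and the second parameter.\<close>
    show "?cl K0 \<subset> ?cl K1"
    proof
      have "?cl K0 \<subseteq> D"
        using D(1) D(2)[OF M0] unfolding K0_def by (intro closure_of_minimal) blast+
      moreover have "?q c (M \<beta>) \<in> ?cl K1"
        using closure_of_subset[of K1 orbit] K c by (auto simp: K1_def)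
      moreover have "?q c (M \<beta>) \<notin> D" using D(2)[of c "M \<beta>"] c M0(2) by blast
      ultimately show "?cl K0 \<noteq> ?cl K1" by blast
    qed (rule closure_of_mono[OF K(1)])
    show "?cl K1 \<subset> ?cl K2"
    proof
      have "?cl K1 \<subseteq> E"
        using E(1) E(2)[OF _ M0(2)] unfolding K1_def by (intro closure_of_minimal) blast+
      moreover have "?q (M \<alpha>) c \<in> ?cl K2"
      proof -
        have "c \<noteq> 0" using c by simp
        then have "?q (M \<alpha>) c \<in> K2" unfolding K2_def using M0(1) by blast
        then show ?thesis using closure_of_subset[OF K(3)] by blast
      qed
      moreover have "?q (M \<alpha>) c \<notin> E" using E(2)[of "M \<alpha>" c] c M0(1) by blast
      ultimately show "?cl K1 \<noteq> ?cl K2" by blast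
    qed (rule closure_of_mono[OF K(2)])
  qed
qed

text \<open>Stability provides a spanning tree inside \<open>S\<close>. No arrow beyond it gives
  dimension 0 and two give at least 2, so dimension 1 leaves exactly one.\<close>

lemma krull_dim_orbit_eq_1_iff: "krull_dim orbit = 1 \<longleftrightarrow> is_spanning_almost_tree Q S"
proof
  assume "is_spanning_almost_tree Q S"
  then show "krull_dim orbit = 1"
    using krull_dim_orbit_almost_tree by (auto simp: is_spanning_almost_tree_def)
next
  assume dim: "krull_dim orbit = 1"
  have "Digraph_Component.connected (Q\<lparr>arcs := S\<rparr>)"
    using M_stable stability verts_nonempty
    by (intro connected_supp_if_stable[of \<theta>]) (auto simp: stable_locus_def)
  then obtain H where H: "H \<subseteq> S" "is_spanning_tree Q H"
    using spanning_tree_exists[OF supp_arcs(2,1)] by blast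
  have "\<not> is_spanning_tree Q S" using krull_dim_orbit_tree dim by auto
  then have "H \<noteq> S" using H(2) by metis
  then obtain \<alpha> where \<alpha>: "\<alpha> \<in> S - H" using H(1) by blast
  have "S - H \<subseteq> {\<alpha>}"
  proof
    fix \<beta> assume "\<beta> \<in> S - H"
    then show "\<beta> \<in> {\<alpha>}" using two_le_krull_dim_orbit[OF H(2,1) \<alpha>, of \<beta>] dim by fastforce
  qed
  then have "S - {\<alpha>} = H" using H(1) \<alpha> by blast
  then show "is_spanning_almost_tree Q S"
    using H(2) \<alpha> supp_arcs(1) \<open>\<not> is_spanning_tree Q S\<close> by (auto simp: is_spanning_almost_tree_def)
qed

end

theorem lemma13:
  fixes Q :: "('v, 'a) pre_digraph"
    and \<theta> :: "('v \<Rightarrow> int) \<Rightarrow> int"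
    and M :: "'a \<Rightarrow> 'k::alg_closed_field"
  assumes "fin_digraph Q"
    and "Digraph_Component.connected Q"
    and "acyclic_quiver Q"
    and "stability_condition Q \<theta>"
    and "generic TYPE('k) Q \<theta>"
    and "M \<in> stable_locus Q \<theta>"
  shows "T0_orbit_dim Q \<theta> (PG_orbit Q M) = 1 \<longleftrightarrow>
    is_spanning_almost_tree Q (supp Q M) \<and>
    stable Q \<theta> (rep_of_arrows Q (supp Q M) :: 'a \<Rightarrow> 'k)"
proof -
  interpret fin_digraph Q by fact
  interpret stable_representation Q \<theta> M
    using assms by unfold_locales
      (auto simp: Digraph_Component.connected_def strongly_connected_def)
  \<comment> \<open>\<open>M\<close> and the representation attached to its support have the same
    support, so stability passes from \<open>M\<close> to the latter.\<close>
  have "supp Q (rep_of_arrows Q S :: 'a \<Rightarrow> 'k) = S"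
    by (rule supp_rep_of_arrows) (rule supp_arcs)
  then have "stable Q \<theta> (rep_of_arrows Q S :: 'a \<Rightarrow> 'k) \<longleftrightarrow> stable Q \<theta> M"
    by (rule stable_cong_supp)
  then show ?thesis
    using assms(6) krull_dim_orbit_eq_1_iff by (simp add: T0_orbit_dim_def orbit_def stable_locus_def)
qed

end
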